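(* Let $p>2$ and $N\in\mathbb{N}$, let $k$, $a$, $A$, $\alpha$ be as in the context, let $\beta$ be any real number with $\alpha-1<\beta<2\alpha-1$, and let $Y_1$ be the corresponding weighted space. Then there exists a solution $v\in Y_1\cap C^\infty(\overline{\mathbb{D}}\setminus\{0\})$ of the linearized $p$-Laplace equation $\operatorname{div}^\circ(A\nabla^\circ v)=0$ in $\mathbb{D}^*$ such that $$\int_0^{2\pi}\frac{\partial v}{\partial n}(1,\theta)\,d\theta\neq 0,$$ where $n$ denotes the outer unit normal of $\partial\mathbb{D}$ (so $\frac{\partial v}{\partial n}(1,\theta)=v_r(1,\theta)$).
   Context: $\mathbb{D}=\{x\in\mathbb{R}^2:|x|<1\}$, $\mathbb{D}^*=\mathbb{D}\setminus\{0\}$; $(r,\theta)$ are polar coordinates, $dA=r\,dr\,d\theta$; subscripts $r,\theta$ denote derivatives. The function $f(r,\theta)=r^ka(\theta)$. Put $b=p/(p-2)$ and let $k=k(p,N)\ge 1$ be the larger root of $(2N-1)(b+1)k^2-2(N^2b+2N-1)k+N^2(1+b)=0$. Let $a\in C^\infty(\mathbb{R})$ be a $2\pi/N$-periodic, not identically zero solution of $a_{\theta\theta}+V(a,a_\theta)a=0$, where $$V(a,a_\theta)=\frac{\bigl((2p-3)k^2-(p-2)k\bigr)a_\theta^2+\bigl((p-1)k^2-(p-2)k\bigr)k^2a^2}{(p-1)a_\theta^2+k^2a^2}.$$ It is known that such an $a$ exists (unique given $a(0),a_\theta(0)$, e.g. $a(0)=1$, $a_\theta(0)=0$) and that $f=r^ka(\theta)$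 is $p$-harmonic in $\mathbb{R}^2$, i.e. $\operatorname{div}(|\nabla f|^{p-2}\nabla f)=0$. Moving frame: $\nabla^\circ v=(e_rv,e_\theta v)=(v_r,\tfrac1r v_\theta)$, and for a vector field $F=(F_1,F_2)$, $\operatorname{div}^\circ F=\frac1r\partial_r(rF_1)+\frac1r\partial_\theta F_2$. The matrix $$A(r,\theta)=r^{(p-2)(k-1)}(a_\theta^2+k^2a^2)^{\frac{p-4}{2}}\begin{pmatrix}a_\theta^2+(p-1)k^2a^2&(p-2)kaa_\theta\\(p-2)kaa_\theta&k^2a^2+(p-1)a_\theta^2\end{pmatrix}.$$ The equation $\operatorname{div}^\circ(A\nabla^\circ v)=0$ is the linearization $\frac{d}{d\varepsilon}\big|_{\varepsilon=0}\Delta_p(f+\varepsilon v)=0$ of the $p$-Laplace equation at $f$. Weighted space: $\alpha=(p-2)(k-1)/2$, and for $\alpha-1<\beta<2\alpha-1$, $$Y_1=\Bigl\{v\in W^{1,2}_{\mathrm{loc}}(\mathbb{D}^* ): v(r,\theta+\tfrac{2\pi}{N})=v(r,\theta),\ \int_{\mathbb{D}}|v|^2r^{2\beta}+|\nabla^\circ v|^2r^{2\alpha}\,dA<\infty\Bigr\}.$$ *)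

theory Defs
  imports "HOL-Analysis.Analysis"
begin

subsection \<open>Smooth functions\<close>

text \<open>\<open>Cn_on n U f\<close>: for open \<open>U\<close>, \<open>f\<close> is of class \<open>C\<^sup>n\<close> on \<open>U\<close>, by recursion on the directional
  derivatives along the coordinate vectors.\<close>

primrec Cn_on :: "nat \<Rightarrow> 'a::euclidean_space set \<Rightarrow> ('a \<Rightarrow> real) \<Rightarrow> bool" where
  "Cn_on 0 U f \<longleftrightarrow> continuous_on U f"
| "Cn_on (Suc n) U f \<longleftrightarrow> (\<forall>x\<in>U. f differentiable (at x)) \<and>
     (\<forall>b\<in>Basis. Cn_on n U (\<lambda>x. frechet_derivative f (at x) b))"

text \<open>For a set \<open>S\<close> that need not be open, \<open>f \<in> C\<^sup>\<infinity>(S)\<close> means that \<open>f\<close> restricted to \<open>S\<close> has a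
  \<open>C\<^sup>\<infinity>\<close> extension to an open neighbourhood of \<open>S\<close>; the values of \<open>f\<close> outside \<open>S\<close> play no role.\<close>

definition smooth_on :: "'a::euclidean_space set \<Rightarrow> ('a \<Rightarrow> real) \<Rightarrow> bool" where
  "smooth_on S f \<longleftrightarrow>
     (\<exists>U g. open U \<and> S \<subseteq> U \<and> (\<forall>x\<in>S. g x = f x) \<and> (\<forall>n. Cn_on n U g))"

subsection \<open>Local Sobolev spaces\<close>

definition L2_loc :: "(real^2) set \<Rightarrow> (real^2 \<Rightarrow> real) set" where
  "L2_loc U = {v. \<forall>K. compact K \<and> K \<subseteq> U \<longrightarrow>
     v \<in> borel_measurable (lebesgue_on K) \<and> integrable (lebesgue_on K) (\<lambda>x. (v x)\<^sup>2)}"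

definition test_function :: "(real^2) set \<Rightarrow> (real^2 \<Rightarrow> real) \<Rightarrow> bool" where
  "test_function U \<phi> \<longleftrightarrow>
     smooth_on UNIV \<phi> \<and> (\<exists>K. compact K \<and> K \<subseteq> U \<and> (\<forall>x. x \<notin> K \<longrightarrow> \<phi> x = 0))"

definition has_weak_L2_gradient ::
    "(real^2) set \<Rightarrow> (real^2 \<Rightarrow> real) \<Rightarrow> (real^2 \<Rightarrow> real^2) \<Rightarrow> bool" where
  "has_weak_L2_gradient U v g \<longleftrightarrow>
     (\<forall>i. (\<lambda>x. g x $ i) \<in> L2_loc U) \<and>
     (\<forall>\<phi> i. test_function U \<phi> \<longrightarrow>
        (LINT x:U|lebesgue. v x * frechet_derivative \<phi> (at x) (axis i 1)) =
        - (LINT x:U|lebesgue. g x $ i * \<phi> x))"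

definition W12_loc :: "(real^2) set \<Rightarrow> (real^2 \<Rightarrow> real) set" where
  "W12_loc U = {v \<in> L2_loc U. \<exists>g. has_weak_L2_gradient U v g}"

subsection \<open>Polar coordinates and the moving frame\<close>

definition punctured_disc :: "(real^2) set" where
  "punctured_disc = ball 0 1 - {0}"

definition polar :: "real \<Rightarrow> real \<Rightarrow> real^2" where
  "polar r \<theta> = vector [r * cos \<theta>, r * sin \<theta>]"

definition e_r :: "real^2 \<Rightarrow> real^2" where
  "e_r x = (1 / norm x) *\<^sub>R x"

definition e_\<theta> :: "real^2 \<Rightarrow> real^2" where
  "e_\<theta> x = (1 / norm x) *\<^sub>R vector [- (x $ 2), x $ 1]"

text \<open>In the next two definitions the arguments are functions of the polar coordinates \<open>(r, \<theta>)\<close>,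
  and vectors are given by their components with respect to the frame \<open>(e_r, e_\<theta>)\<close>.\<close>

definition frame_grad :: "(real \<Rightarrow> real \<Rightarrow> real) \<Rightarrow> real \<Rightarrow> real \<Rightarrow> real^2" where
  "frame_grad V r \<theta> = vector [deriv (\<lambda>s. V s \<theta>) r, (1 / r) * deriv (\<lambda>t. V r t) \<theta>]"

definition frame_div :: "(real \<Rightarrow> real \<Rightarrow> real^2) \<Rightarrow> real \<Rightarrow> real \<Rightarrow> real" where
  "frame_div F r \<theta> =
     (1 / r) * deriv (\<lambda>s. s * (F s \<theta> $ 1)) r + (1 / r) * deriv (\<lambda>t. F r t $ 2) \<theta>"

subsection \<open>The homogeneous \<open>p\<close>-harmonic function \<open>r\<^sup>k a(\<theta>)\<close>\<close>

definition exponent_poly :: "real \<Rightarrow> nat \<Rightarrow> real \<Rightarrow> real" where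
  "exponent_poly p N x = (let b = p / (p - 2); n = real N in
     (2 * n - 1) * (b + 1) * x\<^sup>2 - 2 * (n\<^sup>2 * b + 2 * n - 1) * x + n\<^sup>2 * (1 + b))"

definition is_exponent :: "real \<Rightarrow> nat \<Rightarrow> real \<Rightarrow> bool" where
  "is_exponent p N k \<longleftrightarrow>
     1 \<le> k \<and> exponent_poly p N k = 0 \<and> (\<forall>x. exponent_poly p N x = 0 \<longrightarrow> x \<le> k)"

text \<open>The potential \<open>V(a, a\<^sub>\<theta>)\<close>, with \<open>y\<close> and \<open>z\<close> standing for \<open>a\<close> and \<open>a\<^sub>\<theta>\<close>.\<close>

definition potential :: "real \<Rightarrow> real \<Rightarrow> real \<Rightarrow> real \<Rightarrow> real" where
  "potential p k y z =
     (((2 * p - 3) * k\<^sup>2 - (p - 2) * k) * z\<^sup>2 + ((p - 1) * k\<^sup>2 - (p - 2) * k) * k\<^sup>2 * y\<^sup>2) /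
     ((p - 1) * z\<^sup>2 + k\<^sup>2 * y\<^sup>2)"

definition is_angular_profile :: "real \<Rightarrow> nat \<Rightarrow> real \<Rightarrow> (real \<Rightarrow> real) \<Rightarrow> bool" where
  "is_angular_profile p N k a \<longleftrightarrow>
     smooth_on UNIV a \<and>
     (\<forall>\<theta>. a (\<theta> + 2 * pi / real N) = a \<theta>) \<and>
     (\<exists>\<theta>. a \<theta> \<noteq> 0) \<and>
     (\<forall>\<theta>. deriv (deriv a) \<theta> + potential p k (a \<theta>) (deriv a \<theta>) * a \<theta> = 0)"

definition A_matrix :: "real \<Rightarrow> real \<Rightarrow> (real \<Rightarrow> real) \<Rightarrow> real \<Rightarrow> real \<Rightarrow> real^2^2" where
  "A_matrix p k a r \<theta> =
     (r powr ((p - 2) * (k - 1)) *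
        ((deriv a \<theta>)\<^sup>2 + k\<^sup>2 * (a \<theta>)\<^sup>2) powr ((p - 4) / 2)) *\<^sub>R
     vector [
       vector [(deriv a \<theta>)\<^sup>2 + (p - 1) * k\<^sup>2 * (a \<theta>)\<^sup>2, (p - 2) * k * a \<theta> * deriv a \<theta>],
       vector [(p - 2) * k * a \<theta> * deriv a \<theta>, k\<^sup>2 * (a \<theta>)\<^sup>2 + (p - 1) * (deriv a \<theta>)\<^sup>2]]"

definition solves_linearized :: "real \<Rightarrow> real \<Rightarrow> (real \<Rightarrow> real) \<Rightarrow> (real^2 \<Rightarrow> real) \<Rightarrow> bool" where
  "solves_linearized p k a v \<longleftrightarrow>
     (\<forall>r \<theta>. 0 < r \<and> r < 1 \<longrightarrow>
        frame_div (\<lambda>s t. A_matrix p k a s t *v frame_grad (\<lambda>s t. v (polar s t)) s t) r \<theta> = 0)"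

subsection \<open>The weighted space\<close>

definition alpha :: "real \<Rightarrow> real \<Rightarrow> real" where
  "alpha p k = (p - 2) * (k - 1) / 2"

text \<open>Elements are functions, not classes modulo null sets, and the symmetry is required at every
  point. The frame components of the weak gradient \<open>g\<close> are its inner products with \<open>e_r\<close> and
  \<open>e_\<theta>\<close>; since \<open>g\<close> is unique up to null sets, its choice does not matter.\<close>

definition Y1 :: "nat \<Rightarrow> real \<Rightarrow> real \<Rightarrow> (real^2 \<Rightarrow> real) set" where
  "Y1 N \<alpha> \<beta> = {v \<in> W12_loc punctured_disc.
     (\<forall>r \<theta>. 0 < r \<and> r < 1 \<longrightarrow> v (polar r (\<theta> + 2 * pi / real N)) = v (polar r \<theta>)) \<and>
     (\<exists>g. has_weak_L2_gradient punctured_disc v g \<and>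
        set_integrable lebesgue (ball 0 1)
          (\<lambda>x. (v x)\<^sup>2 * norm x powr (2 * \<beta>) +
               ((g x \<bullet> e_r x)\<^sup>2 + (g x \<bullet> e_\<theta> x)\<^sup>2) * norm x powr (2 * \<alpha>)))}"

text \<open>The outer normal derivative on the unit circle is the radial one; it is one-sided because
  \<open>v\<close> is only given on the closed disc.\<close>

definition normal_deriv :: "(real^2 \<Rightarrow> real) \<Rightarrow> real \<Rightarrow> real" where
  "normal_deriv v \<theta> = vector_derivative (\<lambda>r. v (polar r \<theta>)) (at_left 1)"

end

theory Submission
  imports Defs
begin

text \<open>The Legendre transform linearizes the \<open>p\<close>-Laplace equation: in the coordinates \<open>(q, \<eta>)\<close>, the
  length and the direction of the gradient of \<open>f\<close>, the linearized equation at \<open>f\<close> becomes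
  \<open>v\<^sub>q\<^sub>q + (p - 1) (v\<^sub>q / q + v\<^sub>\<eta>\<^sub>\<eta> / q\<^sup>2) = 0\<close>, which has the solutions \<open>q powr \<nu> * cos (M * \<eta>)\<close> with
  \<open>\<nu>\<^sup>2 + (p - 2) \<nu> = (p - 1) M\<^sup>2\<close>. Here \<open>q\<close> is \<open>r powr (k - 1)\<close> times the square root of
  \<open>\<rho> = k\<^sup>2 a\<^sup>2 + a\<^sub>\<theta>\<^sup>2\<close>, and \<open>\<eta>\<close> decreases by \<open>2\<pi>(N - 1)/N\<close> in one period of \<open>a\<close>, so \<open>M = 2N\<close>
  gives a \<open>2\<pi>/N\<close>-periodic solution \<open>v = r powr ((k - 1) * \<nu>) * \<phi>(\<theta>)\<close>. Since the exponent of \<open>r\<close> is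
  positive, \<open>v\<close> lies in \<open>Y\<^sub>1\<close>.

  With the phase \<open>\<tau>\<close> of \<open>f\<close> in the hodograph plane, a multiple of \<open>\<eta>\<close> up to a constant, the mean
  of \<open>\<phi>\<close> is a nonzero multiple of the integral of \<open>D powr (- s) * (c / D - 1) * cos (2 * (N - 1) * \<tau>)\<close>
  over a period, where \<open>D = cos\<^sup>2 \<tau> + \<kappa>\<^sup>2 sin\<^sup>2 \<tau>\<close>, \<open>\<kappa> < 1 < c\<close> and \<open>s > 0\<close>. The weight is a
  power series in \<open>- cos 2\<tau>\<close> with positive coefficients, so this Fourier coefficient does not vanish.\<close>

subsection \<open>Functions of class \<open>C\<^sup>n\<close>\<close>

text \<open>Openness carries the derivative over by local transformation. This is what allows the
  \<open>frechet_derivative\<close> of the definition to be replaced by an explicit derivative that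
  is known only on \<open>U\<close>.\<close>

lemma Cn_on_cong:
  assumes "open U" "\<And>x. x \<in> U \<Longrightarrow> f x = g x"
  shows "Cn_on n U f \<longleftrightarrow> Cn_on n U g"
proof -
  have imp: "Cn_on n U g" if "\<And>x. x \<in> U \<Longrightarrow> f x = g x" "Cn_on n U f" for f g
    using that
  proof (induction n arbitrary: f g)
    case 0
    then show ?case using continuous_on_cong[of U U f g] by simp
  next
    case (Suc n)
    have d: "(g has_derivative frechet_derivative f (at x)) (at x)" if "x \<in> U" for x
      using that Suc.prems has_derivative_transform_within_open[OF _ \<open>open U\<close> that, of f _ UNIV g]
      by (simp flip: frechet_derivative_works)
    then have "frechet_derivative g (at x) = frechet_derivative f (at x)" if "x \<in> U" for x
      using that frechet_derivative_at by metis
    then have "Cn_on n U (\<lambda>x. frechet_derivative g (at x) b)" if "b \<in> Basis" for b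
      using Suc.IH[of "\<lambda>x. frechet_derivative f (at x) b" "\<lambda>x. frechet_derivative g (at x) b"]
        Suc.prems that by simp
    then show ?case using d by (auto simp: differentiable_def)
  qed
  show ?thesis using imp[of f g] imp[of g f] assms(2) by auto
qed

lemma Cn_on_SucI:
  assumes "open U" "\<And>x. x \<in> U \<Longrightarrow> (f has_derivative f' x) (at x)"
    and "\<And>b. b \<in> Basis \<Longrightarrow> Cn_on n U (\<lambda>x. f' x b)"
  shows "Cn_on (Suc n) U f"
proof -
  have "frechet_derivative f (at x) = f' x" if "x \<in> U" for x
    using assms(2)[OF that] frechet_derivative_at by metis
  then have "Cn_on n U (\<lambda>x. frechet_derivative f (at x) b)" if "b \<in> Basis" for b
    using assms(3)[OF that] Cn_on_cong[OF assms(1), of "\<lambda>x. frechet_derivative f (at x) b" "\<lambda>x. f' x b"]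
    by simp
  then show ?thesis using assms(2) by (auto simp: differentiable_def)
qed

lemma Cn_on_imp_continuous_on:
  assumes "Cn_on n U f" shows "continuous_on U f"
proof (cases n)
  case (Suc m)
  then show ?thesis using assms
    by (auto intro!: continuous_at_imp_continuous_on differentiable_imp_continuous_within)
qed (use assms in simp)

lemma Cn_on_Suc_imp: "Cn_on (Suc n) U f \<Longrightarrow> Cn_on n U f"
proof (induction n arbitrary: f)
  case 0
  then show ?case using Cn_on_imp_continuous_on by fastforce
qed auto

text \<open>The only basis vector of the reals is 1, so the recursion of \<open>Cn_on\<close>
  becomes the usual one over ordinary derivatives.\<close>

lemma Cn_on_Suc_realE:
  fixes f :: "real \<Rightarrow> real"
  assumes l: "Cn_on (Suc n) UNIV f"
  obtains f' where "\<And>x. (f has_real_derivative f' x) (at x)" "Cn_on n UNIV f'"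
proof
  show "(f has_real_derivative frechet_derivative f (at x) 1) (at x)" for x
  proof (rule has_derivative_imp_has_field_derivative)
    show d: "(f has_derivative frechet_derivative f (at x)) (at x)"
      using l by (simp flip: frechet_derivative_works)
    show "h * frechet_derivative f (at x) 1 = frechet_derivative f (at x) h" for h
      using linear_scale[OF has_derivative_linear[OF d], of h 1] by simp
  qed
  show "Cn_on n UNIV (\<lambda>x. frechet_derivative f (at x) 1)" using l by simp
qed

lemma Cn_on_Suc_realI:
  fixes f :: "real \<Rightarrow> real"
  assumes "\<And>x. (f has_real_derivative f' x) (at x)" "Cn_on n UNIV f'"
  shows "Cn_on (Suc n) UNIV f"
  using assms by (intro Cn_on_SucI[where f' = "\<lambda>x h. f' x * h"]) (auto simp: has_field_derivative_def)

lemma Cn_on_real_deriv: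
  fixes f :: "real \<Rightarrow> real"
  assumes "Cn_on (Suc n) UNIV f" "\<And>x. (f has_real_derivative f' x) (at x)"
  shows "Cn_on n UNIV f'"
proof -
  obtain g where "\<And>x. (f has_real_derivative g x) (at x)" "Cn_on n UNIV g"
    using Cn_on_Suc_realE[OF assms(1)] by blast
  then have "g = f'" using assms(2) DERIV_unique by blast
  then show ?thesis using \<open>Cn_on n UNIV g\<close> by simp
qed

lemma Cn_on_const: "Cn_on n UNIV (\<lambda>x::real. c)"
proof (induction n arbitrary: c)
  case (Suc n)
  then show ?case by (intro Cn_on_Suc_realI[where f' = "\<lambda>x. 0"]) auto
qed simp

lemma Cn_on_add:
  fixes f g :: "real \<Rightarrow> real"
  shows "Cn_on n UNIV f \<Longrightarrow> Cn_on n UNIV g \<Longrightarrow> Cn_on n UNIV (\<lambda>x. f x + g x)"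
proof (induction n arbitrary: f g)
  case 0
  then show ?case by (auto intro: continuous_intros)
next
  case (Suc n)
  obtain f' where f': "\<And>x. (f has_real_derivative f' x) (at x)" "Cn_on n UNIV f'"
    using Cn_on_Suc_realE[OF Suc.prems(1)] by blast
  obtain g' where g': "\<And>x. (g has_real_derivative g' x) (at x)" "Cn_on n UNIV g'"
    using Cn_on_Suc_realE[OF Suc.prems(2)] by blast
  have "((\<lambda>x. f x + g x) has_real_derivative f' x + g' x) (at x)" for x
    by (auto intro!: derivative_eq_intros f' g')
  moreover have "Cn_on n UNIV (\<lambda>x. f' x + g' x)"
    by (intro Suc.IH f' g')
  ultimately show ?case by (rule Cn_on_Suc_realI)
qed

lemma Cn_on_mult:
  fixes f g :: "real \<Rightarrow> real"
  shows "Cn_on n UNIV f \<Longrightarrow> Cn_on n UNIV g \<Longrightarrow> Cn_on n UNIV (\<lambda>x. f x * g x)"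
proof (induction n arbitrary: f g)
  case 0
  then show ?case by (auto intro: continuous_intros)
next
  case (Suc n)
  obtain f' where f': "\<And>x. (f has_real_derivative f' x) (at x)" "Cn_on n UNIV f'"
    using Cn_on_Suc_realE[OF Suc.prems(1)] by blast
  obtain g' where g': "\<And>x. (g has_real_derivative g' x) (at x)" "Cn_on n UNIV g'"
    using Cn_on_Suc_realE[OF Suc.prems(2)] by blast
  have "((\<lambda>x. f x * g x) has_real_derivative f' x * g x + f x * g' x) (at x)" for x
    by (auto intro!: derivative_eq_intros f' g')
  moreover have "Cn_on n UNIV (\<lambda>x. f' x * g x + f x * g' x)"
    by (intro Cn_on_add Suc.IH Suc.prems[THEN Cn_on_Suc_imp] f' g')
  ultimately show ?case by (rule Cn_on_Suc_realI)
qed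

lemma Cn_on_minus:
  fixes f :: "real \<Rightarrow> real"
  shows "Cn_on n UNIV f \<Longrightarrow> Cn_on n UNIV (\<lambda>x. - f x)"
  using Cn_on_mult[OF Cn_on_const[of n "- 1"]] by simp

lemma Cn_on_powr:
  fixes f :: "real \<Rightarrow> real"
  shows "Cn_on n UNIV f \<Longrightarrow> (\<And>x. f x > 0) \<Longrightarrow> Cn_on n UNIV (\<lambda>x. f x powr s)"
proof (induction n arbitrary: f s)
  case 0
  have "f x \<noteq> 0" for x using "0.prems"(2)[of x] by simp
  then show ?case using "0.prems"(1) by (simp add: continuous_on_powr)
next
  case (Suc n)
  obtain f' where f': "\<And>x. (f has_real_derivative f' x) (at x)" "Cn_on n UNIV f'"
    using Cn_on_Suc_realE[OF Suc.prems(1)] by blast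
  have "((\<lambda>x. f x powr s) has_real_derivative s * f x powr (s - 1) * f' x) (at x)" for x
    by (rule DERIV_chain2[OF has_real_derivative_powr[OF Suc.prems(2)] f'(1)])
  moreover have "Cn_on n UNIV (\<lambda>x. s * f x powr (s - 1) * f' x)"
    by (intro Cn_on_mult Cn_on_const Suc.IH f'(2) Cn_on_Suc_imp[OF Suc.prems(1)] Suc.prems(2))
  ultimately show ?case by (rule Cn_on_Suc_realI)
qed

lemma Cn_on_inverse:
  fixes f :: "real \<Rightarrow> real"
  assumes "Cn_on n UNIV f" "\<And>x. f x > 0"
  shows "Cn_on n UNIV (\<lambda>x. inverse (f x))"
  using Cn_on_powr[OF assms, of "- 1"] assms(2) by (simp add: powr_minus less_imp_le)

lemma Cn_on_sin_cos:
  fixes f :: "real \<Rightarrow> real"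
  shows "Cn_on n UNIV f \<Longrightarrow> Cn_on n UNIV (\<lambda>x. sin (f x)) \<and> Cn_on n UNIV (\<lambda>x. cos (f x))"
proof (induction n arbitrary: f)
  case 0
  then show ?case by (auto intro!: continuous_intros)
next
  case (Suc n)
  obtain f' where f': "\<And>x. (f has_real_derivative f' x) (at x)" "Cn_on n UNIV f'"
    using Cn_on_Suc_realE[OF Suc.prems(1)] by blast
  have "Cn_on n UNIV (\<lambda>x. sin (f x))" "Cn_on n UNIV (\<lambda>x. cos (f x))"
    using Suc.IH[OF Cn_on_Suc_imp[OF Suc.prems]] by auto
  then have "Cn_on n UNIV (\<lambda>x. cos (f x) * f' x)" "Cn_on n UNIV (\<lambda>x. - (sin (f x) * f' x))"
    by (simp_all add: Cn_on_mult Cn_on_minus f')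
  then show ?case
    by (intro conjI Cn_on_Suc_realI[where f' = "\<lambda>x. cos (f x) * f' x"]
        Cn_on_Suc_realI[where f' = "\<lambda>x. - (sin (f x) * f' x)"]) (auto intro!: derivative_eq_intros f')
qed

section \<open>Tools for differential equations on the line\<close>

lemma deriv_zero_imp_const:
  fixes f :: "real \<Rightarrow> real"
  assumes "\<And>x. (f has_real_derivative 0) (at x)"
  shows "f x = f y"
  using DERIV_isconst_all[of f] assms by blast

text \<open>A two-sided Gronwall argument: \<open>e\<close> times exp(- K x) is nonincreasing and
  \<open>e\<close> times exp(K x) is nondecreasing, so a zero of \<open>e\<close> propagates to the
  right by the first and to the left by the second.\<close>

lemma linear_growth_nonzero:
  fixes e :: "real \<Rightarrow> real"
  assumes d: "\<And>x. (e has_real_derivative e' x) (at x)" 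
    and b: "\<And>x. \<bar>e' x\<bar> \<le> K * e x" and nn: "\<And>x. 0 \<le> e x" and z: "e x0 = 0"
  shows "e x = 0"
proof -
  have 1: "((\<lambda>x. e x * exp (- K * x)) has_real_derivative (e' x - K * e x) * exp (- K * x)) (at x)" for x
    by (auto intro!: derivative_eq_intros d simp: algebra_simps)
  have 2: "((\<lambda>x. e x * exp (K * x)) has_real_derivative (e' x + K * e x) * exp (K * x)) (at x)" for x
    by (auto intro!: derivative_eq_intros d simp: algebra_simps)
  have "e x \<le> 0"
  proof (cases "x0 \<le> x")
    case True
    have "e x * exp (- K * x) \<le> e x0 * exp (- K * x0)"
    proof (rule DERIV_nonpos_imp_nonincreasing[OF True])
      fix t
      have "(e' t - K * e t) * exp (- K * t) \<le> 0"
        using b[of t] by (intro mult_nonpos_nonneg) auto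
      then show "\<exists>y. ((\<lambda>x. e x * exp (- K * x)) has_real_derivative y) (at t) \<and> y \<le> 0"
        using 1 by blast
    qed
    then have "e x * exp (- K * x) \<le> 0" using z by simp
    then show ?thesis by (simp add: mult_le_0_iff)
  next
    case False
    have "e x * exp (K * x) \<le> e x0 * exp (K * x0)"
    proof (rule DERIV_nonneg_imp_nondecreasing[of x x0 "\<lambda>x. e x * exp (K * x)"])
      show "x \<le> x0" using False by simp
      fix t
      have "0 \<le> (e' t + K * e t) * exp (K * t)"
        using b[of t] by (intro mult_nonneg_nonneg) auto
      then show "\<exists>y. ((\<lambda>x. e x * exp (K * x)) has_real_derivative y) (at t) \<and> 0 \<le> y"
        using 2 by blast
    qed
    then have "e x * exp (K * x) \<le> 0" using z by simp
    then show ?thesis by (simp add: mult_le_0_iff)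
  qed
  then show ?thesis using nn[of x] by simp
qed

lemma exists_antiderivative:
  fixes f :: "real \<Rightarrow> real"
  assumes "\<And>x. isCont f x"
  obtains F where "\<And>x. (F has_real_derivative f x) (at x)"
  using einterval_antiderivative[of "-\<infinity>" "\<infinity>" f] assms
  by (auto simp: has_real_derivative_iff_has_vector_derivative)

text \<open>In complex notation z = x + i y solves z' = (u + i w) z, so the argument of z has
  derivative w. It is built as an antiderivative of \<open>w\<close> with the right value at 0, not
  by gluing local branches.\<close>

lemma polar_lift:
  fixes x y :: "real \<Rightarrow> real"
  assumes dx: "\<And>t. (x has_real_derivative u t * x t - w t * y t) (at t)"
    and dy: "\<And>t. (y has_real_derivative u t * y t + w t * x t) (at t)"
    and u: "\<And>t. isCont u t" and w: "\<And>t. isCont w t" and nz: "\<And>t. 0 < (x t)\<^sup>2 + (y t)\<^sup>2"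
  obtains \<tau> where "\<And>t. (\<tau> has_real_derivative w t) (at t)"
    and "\<And>t. x t = sqrt ((x t)\<^sup>2 + (y t)\<^sup>2) * cos (\<tau> t)"
    and "\<And>t. y t = sqrt ((x t)\<^sup>2 + (y t)\<^sup>2) * sin (\<tau> t)"
proof -
  obtain U where U: "\<And>t. (U has_real_derivative u t) (at t)"
    using exists_antiderivative[OF u] by blast
  obtain W where W: "\<And>t. (W has_real_derivative w t) (at t)"
    using exists_antiderivative[OF w] by blast
  define R where "R t = sqrt ((x t)\<^sup>2 + (y t)\<^sup>2)" for t
  have R: "R t > 0" "(R t)\<^sup>2 = (x t)\<^sup>2 + (y t)\<^sup>2" for t
    using nz[of t] by (auto simp: R_def)
  have "(x 0 / R 0)\<^sup>2 + (y 0 / R 0)\<^sup>2 = 1"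
    using R(1)[of 0] by (simp add: power_divide flip: add_divide_distrib R(2))
  then obtain c where c: "x 0 / R 0 = cos c" "y 0 / R 0 = sin c"
    using sincos_total_2pi by metis
  define T where "T t = W t - W 0 + c" for t
  have T: "(T has_real_derivative w t) (at t)" for t
    unfolding T_def by (auto intro!: derivative_eq_intros W)
  \<comment> \<open>This fact and the next one concern the imaginary and the real part of z exp(- U
    - i T), which is constant; at 0 it is real and positive.\<close>
  have q: "((\<lambda>t. (y t * cos (T t) - x t * sin (T t)) * exp (- U t)) has_real_derivative 0) (at t)" for t
    by (rule derivative_eq_intros dx dy T U refl)+ (simp add: algebra_simps)
  have s: "((\<lambda>t. (x t * cos (T t) + y t * sin (T t)) * exp (- U t)) has_real_derivative 0) (at t)" for t
    by (rule derivative_eq_intros dx dy T U refl)+ (simp add: algebra_simps)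
  have x0: "x 0 = R 0 * cos c" "y 0 = R 0 * sin c" using c R(1)[of 0] by (auto simp: field_simps)
  have T0: "T 0 = c" by (simp add: T_def)
  have q0: "y t * cos (T t) - x t * sin (T t) = 0" for t
    using deriv_zero_imp_const[OF q, of t 0] by (simp add: T0 x0)
  have "(x t * cos (T t) + y t * sin (T t)) * exp (- U t) = R 0 * exp (- U 0)" for t
    using deriv_zero_imp_const[OF s, of t 0]
    by (simp add: T0 x0 mult.assoc flip: distrib_left power2_eq_square)
  then have s0: "x t * cos (T t) + y t * sin (T t) > 0" for t
    by (metis R(1) exp_gt_zero zero_less_mult_pos2 mult_pos_pos)
  have sR: "x t * cos (T t) + y t * sin (T t) = R t" for t
  proof -
    have "(x t * cos (T t) + y t * sin (T t))\<^sup>2 + (y t * cos (T t) - x t * sin (T t))\<^sup>2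
        = ((x t)\<^sup>2 + (y t)\<^sup>2) * ((sin (T t))\<^sup>2 + (cos (T t))\<^sup>2)"
      by algebra
    then have "(x t * cos (T t) + y t * sin (T t))\<^sup>2 = (R t)\<^sup>2"
      unfolding q0 R(2) sin_cos_squared_add by simp
    then show ?thesis using s0[of t] R(1)[of t] by (simp add: power2_eq_iff)
  qed
  have "x t = R t * cos (T t)" for t
  proof -
    have "x t * ((sin (T t))\<^sup>2 + (cos (T t))\<^sup>2) = R t * cos (T t)"
      using q0[of t] unfolding sR[of t, symmetric] by algebra
    then show ?thesis by simp
  qed
  moreover have "y t = R t * sin (T t)" for t
  proof -
    have "y t * ((sin (T t))\<^sup>2 + (cos (T t))\<^sup>2) = R t * sin (T t)"
      using q0[of t] unfolding sR[of t, symmetric] by algebra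
    then show ?thesis by simp
  qed
  ultimately show ?thesis using that[OF T] unfolding R_def by blast
qed

subsection \<open>Fourier coefficients of powers of an ellipse\<close>

text \<open>The formula 2 cos y cos (j y) = cos ((j + 1) y) + cos ((j - 1) y) lowers the power by
  one, and at power 0 only frequency 0 has a nonzero integral. All values are thus averages of
  nonnegative ones, and positivity passes from (i, i) to (i + 1, i + 1). An integer \<open>j\<close>
  admits the negative frequencies met on the way.\<close>

lemma integral_cos_power_cos:
  fixes j :: int and i :: nat
  defines "w \<equiv> \<lambda>i (j::int). integral {0..2 * pi} (\<lambda>t. cos (2 * t + pi) ^ i * cos (of_int j * (2 * t + pi)))"
  shows "w i j \<ge> 0" and "w i (int i) > 0"
proof -
  have int: "(\<lambda>t. cos (2 * t + pi) ^ i * cos (of_int j * (2 * t + pi))) integrable_on {0..2 * pi}" for i and j :: int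
    by (intro integrable_continuous_real continuous_intros)
  have w0: "w 0 j = (if j = 0 then 2 * pi else 0)" for j
  proof (cases "j = 0")
    case False
    have d: "((\<lambda>t. sin (of_int j * (2 * t + pi)) / (2 * of_int j)) has_real_derivative cos (of_int j * (2 * t + pi))) (at t within S)" for t S
      using False by (auto intro!: derivative_eq_intros)
    have "((\<lambda>t. cos (of_int j * (2 * t + pi))) has_integral
        (sin (of_int j * (2 * (2 * pi) + pi)) / (2 * of_int j) - sin (of_int j * (2 * 0 + pi)) / (2 * of_int j))) {0..2 * pi}"
      using d by (intro fundamental_theorem_of_calculus) (auto simp flip: has_real_derivative_iff_has_vector_derivative)
    moreover have "sin (of_int j * (2 * (2 * pi) + pi)) = sin (of_int (5 * j) * pi)"
      by (simp add: algebra_simps)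
    then have "sin (of_int j * (2 * (2 * pi) + pi)) = 0"
      by (simp only: mult.commute[of _ pi] sin_npi_int)
    moreover have "sin (of_int j * (2 * 0 + pi)) = 0"
      using sin_npi_int[of j] by (simp add: mult.commute)
    ultimately show ?thesis using False by (simp add: w_def integral_unique)
  qed (simp add: w_def)
  have rec: "w (Suc i) j = (w i (j + 1) + w i (j - 1)) / 2" for i j
  proof -
    have "cos (2 * t + pi) ^ Suc i * cos (of_int j * (2 * t + pi)) =
       (cos (2 * t + pi) ^ i * cos (of_int (j + 1) * (2 * t + pi))
        + cos (2 * t + pi) ^ i * cos (of_int (j - 1) * (2 * t + pi))) / 2" for t
    proof -
      define y where "y = 2 * t + pi"
      have "cos (of_int (j + 1) * y) + cos (of_int (j - 1) * y) = 2 * cos y * cos (of_int j * y)"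
        by (simp add: distrib_right left_diff_distrib cos_add cos_diff)
      then show ?thesis by (simp add: y_def[symmetric] flip: distrib_left)
    qed
    then have "w (Suc i) j = integral {0..2 * pi} (\<lambda>t. (cos (2 * t + pi) ^ i * cos (of_int (j + 1) * (2 * t + pi))
        + cos (2 * t + pi) ^ i * cos (of_int (j - 1) * (2 * t + pi))) / 2)"
      by (simp only: w_def)
    also have "\<dots> = (w i (j + 1) + w i (j - 1)) / 2"
      unfolding w_def integral_divide by (subst integral_add[OF int int]) simp
    finally show ?thesis .
  qed
  have nn: "w i j \<ge> 0" for i j
    by (induction i arbitrary: j) (auto simp: w0 rec)
  then show "w i j \<ge> 0" .
  show "w i (int i) > 0"
  proof (induction i)
    case (Suc i)
    then show ?case using nn[of i "int (Suc i) + 1"] by (simp add: rec add_nonneg_pos)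
  qed (simp add: w0)
qed

text \<open>The shift by pi absorbs the sign, so that cosine powers and frequencies share one
  argument.\<close>

lemma uminus_one_power_mult_cos: "(- 1) ^ n * cos (2 * real n * t) = cos (of_int (int n) * (2 * t + pi))"
  by (simp add: distrib_left cos_add mult_ac)

text \<open>Rising factorials make the positivity of all coefficients for \<open>s > 0\<close>
  visible; the sign of the generalized binomial coefficient cancels against that of the power of
  \<open>- y\<close>.\<close>

lemma binomial_series_pochhammer:
  fixes s :: real
  assumes "\<bar>y\<bar> < 1"
  shows "(\<lambda>i. pochhammer s i / fact i * y ^ i) sums ((1 - y) powr (- s))"
proof -
  have "((- s) gchoose i) * (- y) ^ i = pochhammer s i / fact i * y ^ i" for i
  proof -
    have "((- s) gchoose i) * (- y) ^ i = ((- 1) ^ i * (- 1) ^ i) * (pochhammer s i / fact i * y ^ i)"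
      unfolding gbinomial_pochhammer power_minus[of y] by simp
    then show ?thesis by (simp flip: power_mult_distrib)
  qed
  then show ?thesis using gen_binomial_real[of "- y" "- s"] assms by simp
qed

text \<open>In the variable x = - cos (2 t) the weight is c D^(-(s+1)) - D^(-s) with D = A (1 - q
  x). Each power has a positive binomial series in x, and the first dominates coefficientwise
  because A < 1, c \<ge> 1 and rising factorials grow with their base. Termwise integration gives
  nonnegative numbers, the n-th one positive.\<close>

lemma fourier_coefficient_pos:
  fixes \<kappa> s c :: real and n :: nat
  assumes \<kappa>: "0 < \<kappa>" "\<kappa> < 1" and s: "s > 0" and c: "c \<ge> 1"
  defines "D \<equiv> \<lambda>t. (cos t)\<^sup>2 + \<kappa>\<^sup>2 * (sin t)\<^sup>2"
  shows "(- 1) ^ n * integral {0..2 * pi} (\<lambda>t. D t powr (- s) * (c / D t - 1) * cos (2 * real n * t)) > 0"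
proof -
  \<comment> \<open>\<open>A\<close> is the mean of \<open>D\<close> and \<open>q\<close> its
    relative amplitude, by the double angle formula.\<close>
  define A where "A = (1 + \<kappa>\<^sup>2) / 2"
  define q where "q = (1 - \<kappa>\<^sup>2) / (1 + \<kappa>\<^sup>2)"
  have k2: "0 < \<kappa>\<^sup>2" "\<kappa>\<^sup>2 < 1" using \<kappa> by (auto simp: abs_square_less_1)
  have A: "0 < A" "A < 1" using k2 by (auto simp: A_def add_pos_pos)
  have q: "0 < q" "q < 1" using k2 by (auto simp: q_def divide_less_eq_1 intro!: divide_pos_pos add_pos_pos)
  have Aq: "A * q = (1 - \<kappa>\<^sup>2) / 2" 
  proof -
    have "1 + \<kappa>\<^sup>2 \<noteq> 0" using k2 by linarith
    then show ?thesis unfolding A_def q_def times_divide_times_eq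
      by (simp only: mult.commute[of 2] nonzero_mult_divide_mult_cancel_left not_False_eq_True)
  qed
  define x where "x t = cos (2 * t + pi)" for t :: real
  have x1: "\<bar>x t\<bar> \<le> 1" for t by (simp add: x_def)
  have D: "D t = A * (1 - q * x t)" for t
  proof -
    have "A * (1 - q * x t) = A + (A * q) * cos (2 * t)" by (simp add: x_def algebra_simps)
    also have "\<dots> = D t"
      unfolding Aq unfolding D_def sin_squared_eq cos_double_cos A_def by (simp add: field_simps)
    finally show ?thesis by simp
  qed
  have qx: "\<bar>q * x t\<bar> < 1" for t
  proof -
    have "q * \<bar>x t\<bar> \<le> q * 1" using q by (intro mult_left_mono x1) auto
    also have "\<dots> < 1" using q by simp
    finally show ?thesis using q by (simp add: abs_mult)
  qed
  \<comment> \<open>The i-th coefficient of the weight as a power series in \<open>x t\<close>; the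
    power of q comes from the argument \<open>q * x t\<close> of the binomial series.\<close>
  define h where "h i = (c * A powr (- (s + 1)) * (pochhammer (s + 1) i / fact i)
      - A powr (- s) * (pochhammer s i / fact i)) * q ^ i" for i
  have h_pos: "h i > 0" for i
  proof -
    have p: "0 < pochhammer s i" using s by (rule pochhammer_pos)
    have "pochhammer s i \<le> pochhammer (s + 1) i"
      unfolding pochhammer_prod using s by (intro prod_mono) auto
    moreover have "A powr (- s) < A powr (- (s + 1))" using A by (intro powr_less_mono') auto
    then have "1 * A powr (- s) < c * A powr (- (s + 1))"
      using c by (intro mult_le_less_imp_less) auto
    ultimately have "A powr (- s) * (pochhammer s i / fact i) < c * A powr (- (s + 1)) * (pochhammer (s + 1) i / fact i)"
      using p by (intro mult_less_le_imp_less divide_right_mono) auto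
    then show ?thesis using q by (simp add: h_def)
  qed
  have ser: "(\<lambda>i. h i * y ^ i) sums (c * A powr (- (s + 1)) * (1 - q * y) powr (- (s + 1)) - A powr (- s) * (1 - q * y) powr (- s))"
    if "\<bar>q * y\<bar> < 1" for y
  proof -
    have "(\<lambda>i. c * A powr (- (s + 1)) * (pochhammer (s + 1) i / fact i * (q * y) ^ i)
        - A powr (- s) * (pochhammer s i / fact i * (q * y) ^ i)) sums
      (c * A powr (- (s + 1)) * (1 - q * y) powr (- (s + 1)) - A powr (- s) * (1 - q * y) powr (- s))"
      by (intro sums_diff sums_mult binomial_series_pochhammer that)
    then show ?thesis by (simp add: h_def algebra_simps power_mult_distrib)
  qed
  have f: "(\<lambda>i. h i * x t ^ i) sums (D t powr (- s) * (c / D t - 1))" for t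
  proof -
    have z: "0 < 1 - q * x t" using qx[of t] by auto
    have "D t powr (- s) * (c / D t - 1) = c * D t powr (- (s + 1)) - D t powr (- s)"
    proof -
      have "D t > 0" using z A by (simp add: D)
      then have "D t powr (- (s + 1)) = D t powr (- s) / D t"
        using powr_add[of "D t" "- s" "- 1"] by (simp add: powr_neg_one)
      then show ?thesis by (simp add: algebra_simps)
    qed
    also have "\<dots> = c * A powr (- (s + 1)) * (1 - q * x t) powr (- (s + 1)) - A powr (- s) * (1 - q * x t) powr (- s)"
      using A z by (simp add: D powr_mult)
    finally show ?thesis using ser[OF qx[of t]] by simp
  qed
  define g where "g i t = h i * (x t ^ i * cos (of_int (int n) * (2 * t + pi)))" for i t
  define F where "F t = (- 1) ^ n * (D t powr (- s) * (c / D t - 1) * cos (2 * real n * t))" for t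
  have gF: "(\<lambda>i. g i t) sums F t" for t
  proof -
    have "(\<lambda>i. h i * x t ^ i * ((- 1) ^ n * cos (2 * real n * t))) sums
       (D t powr (- s) * (c / D t - 1) * ((- 1) ^ n * cos (2 * real n * t)))"
      by (intro sums_mult2 f)
    moreover have "F t = D t powr (- s) * (c / D t - 1) * ((- 1) ^ n * cos (2 * real n * t))"
      by (simp only: F_def mult_ac)
    ultimately show ?thesis unfolding uminus_one_power_mult_cos g_def by (simp only: mult.assoc)
  qed
  \<comment> \<open>The coefficients themselves are a summable majorant, since the series converges
    at 1 because q < 1.\<close>
  have "uniform_limit (cbox 0 (2 * pi)) (\<lambda>m t. \<Sum>i<m. g i t) (\<lambda>t. suminf (\<lambda>i. g i t)) sequentially"
  proof (rule Weierstrass_m_test)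
    show "norm (g i t) \<le> h i" for i t
    proof -
      have "\<bar>x t\<bar> ^ i * \<bar>cos (of_int (int n) * (2 * t + pi))\<bar> \<le> 1 * 1"
        by (intro mult_mono power_le_one x1) auto
      then show ?thesis using h_pos[of i] by (simp add: g_def abs_mult power_abs)
    qed
    show "summable h" using ser[of 1] q by (auto simp: sums_iff)
  qed
  then have ul: "uniform_limit (cbox 0 (2 * pi)) (\<lambda>m t. \<Sum>i<m. g i t) F sequentially"
    using gF by (simp add: sums_iff)
  have gi: "g i integrable_on {0..2 * pi}" for i
    unfolding g_def x_def by (intro integrable_continuous_real continuous_intros)
  obtain I J where I: "\<And>m. ((\<lambda>t. \<Sum>i<m. g i t) has_integral I m) (cbox 0 (2 * pi))"
    and J: "(F has_integral J) (cbox 0 (2 * pi))" and lim: "I \<longlonglongrightarrow> J"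
    by (rule uniform_limit_integral_cbox[OF ul])
      (auto intro!: continuous_intros simp: g_def x_def)
  define w where "w i = integral {0..2 * pi} (\<lambda>t. cos (2 * t + pi) ^ i * cos (of_int (int n) * (2 * t + pi)))" for i
  have w: "w i \<ge> 0" "w n > 0" for i
    unfolding w_def by (rule integral_cos_power_cos)+
  have Im: "I m = (\<Sum>i<m. h i * w i)" for m
  proof -
    have "I m = integral {0..2 * pi} (\<lambda>t. \<Sum>i<m. g i t)" using I[of m] by (simp add: integral_unique)
    also have "\<dots> = (\<Sum>i<m. integral {0..2 * pi} (g i))" by (rule integral_sum) (auto intro: gi)
    also have "\<dots> = (\<Sum>i<m. h i * w i)" by (simp only: g_def[abs_def] w_def x_def integral_mult_right)
    finally show ?thesis .
  qed
  \<comment> \<open>All terms are nonnegative, so from m = n + 1 on the partial sums are at least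
    the n-th term, and so is their limit.\<close>
  have "h n * w n \<le> I m" if "m > n" for m
    unfolding Im using that h_pos w by (intro member_le_sum) (auto simp: less_imp_le)
  then have "h n * w n \<le> J"
    by (intro LIMSEQ_le_const[OF lim] exI[of _ "Suc n"]) auto
  then have "0 < J" using h_pos[of n] w(2) by (meson less_le_trans mult_pos_pos)
  moreover have "J = integral {0..2 * pi} F" using J by (simp add: integral_unique)
  ultimately show ?thesis unfolding F_def by simp
qed

subsection \<open>Weak derivatives and integrability of powers of the norm\<close>

lemma integrable_continuous_compact_support:
  fixes f :: "'a::euclidean_space \<Rightarrow> real"
  assumes "compact K" "continuous_on UNIV f" "\<And>x. x \<notin> K \<Longrightarrow> f x = 0"
  shows "integrable lborel f"
proof -
  have "integrable lborel (\<lambda>x. indicator K x *\<^sub>R f x)"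
    using assms by (intro borel_integrable_compact continuous_on_subset[of UNIV f K]) auto
  moreover have "(\<lambda>x. indicator K x *\<^sub>R f x) = f"
    using assms(3) by (auto simp: indicator_def fun_eq_iff)
  ultimately show ?thesis by simp
qed

text \<open>The difference quotients have integral zero by translation invariance, and they are
  dominated on a fixed ball.\<close>

lemma integral_directional_derivative_eq_0:
  fixes h :: "'a::euclidean_space \<Rightarrow> real"
  assumes d: "\<And>x. (h has_derivative h' x) (at x)" and c: "continuous_on UNIV (\<lambda>x. h' x e)"
    and supp: "\<And>x. x \<notin> cball 0 R \<Longrightarrow> h x = 0"
  shows "integral\<^sup>L lborel (\<lambda>x. h' x e) = 0"
proof -
  have hc: "continuous_on UNIV h"
    by (intro continuous_at_imp_continuous_on ballI has_derivative_continuous[OF d])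
  have hi: "integrable lborel h"
    by (rule integrable_continuous_compact_support[OF compact_cball hc supp])
  have shift: "integrable lborel (\<lambda>x. h (x + u)) \<and> integral\<^sup>L lborel (\<lambda>x. h (x + u)) = integral\<^sup>L lborel h" for u
  proof -
    have D: "distr lborel borel ((+) u) = lborel" by (rule lborel_distr_plus)
    have m: "h \<in> borel_measurable borel" using hc by (rule borel_measurable_continuous_onI)
    have "integrable (distr lborel borel ((+) u)) h = integrable lborel (\<lambda>x. h (u + x))"
      by (rule integrable_distr_eq) (use m in auto)
    moreover have "integral\<^sup>L (distr lborel borel ((+) u)) h = integral\<^sup>L lborel (\<lambda>x. h (u + x))"
      by (rule integral_distr) (use m in auto)
    ultimately show ?thesis unfolding D using hi by (simp add: add.commute)
  qed
  define t where "t n = 1 / real (Suc n)" for n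
  have t: "0 < t n" "t n \<le> 1" for n by (auto simp: t_def divide_le_eq)
  have t0: "t \<longlonglongrightarrow> 0" unfolding t_def by (rule LIMSEQ_Suc[OF lim_1_over_n])
  define f where "f n x = (h (x + t n *\<^sub>R e) - h x) / t n" for n x
  have f0: "integral\<^sup>L lborel (f n) = 0" for n
  proof -
    have "integral\<^sup>L lborel (f n) = (integral\<^sup>L lborel (\<lambda>x. h (x + t n *\<^sub>R e)) - integral\<^sup>L lborel h) / t n"
      unfolding f_def using shift[of "t n *\<^sub>R e"] hi by simp
    then show ?thesis using shift[of "t n *\<^sub>R e"] by simp
  qed
  have dl: "((\<lambda>s. h (x + s *\<^sub>R e)) has_real_derivative h' (x + s *\<^sub>R e) e) (at s)" for x s
  proof -
    have "((\<lambda>s. h (x + s *\<^sub>R e)) has_derivative (\<lambda>y. h' (x + s *\<^sub>R e) (y *\<^sub>R e))) (at s)"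
      by (rule has_derivative_compose[OF _ d]) (auto intro!: derivative_eq_intros)
    moreover have "(\<lambda>y. h' (x + s *\<^sub>R e) (y *\<^sub>R e)) = (\<lambda>y. h' (x + s *\<^sub>R e) e * y)"
      by (rule ext) (simp add: linear_scale[OF has_derivative_linear[OF d]])
    ultimately show ?thesis by (simp add: has_field_derivative_def)
  qed
  have lim: "(\<lambda>n. f n x) \<longlonglongrightarrow> h' x e" for x
  proof -
    have L: "((\<lambda>s. (h (x + s *\<^sub>R e) - h x) / s) \<longlongrightarrow> h' x e) (at 0)"
      using dl[of x 0] by (simp add: DERIV_def)
    have "t n \<noteq> 0" for n using t(1)[of n] by simp
    then have "filterlim t (at 0) sequentially" using t0 by (simp add: filterlim_at)
    from filterlim_compose[OF L this] show ?thesis by (simp add: f_def)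
  qed
  \<comment> \<open>Since the step \<open>t n\<close> is at most 1, the quotients vanish outside
    radius R + norm e, and the mean value point lies at most another norm e away.\<close>
  have "compact ((\<lambda>x. h' x e) ` cball 0 (R + 2 * norm e))"
    by (intro compact_continuous_image continuous_on_subset[OF c]) auto
  then have "\<exists>C. \<forall>x\<in>cball 0 (R + 2 * norm e). \<bar>h' x e\<bar> \<le> C"
    by (auto dest!: compact_imp_bounded simp: bounded_iff)
  then obtain C where C: "\<And>x. x \<in> cball 0 (R + 2 * norm e) \<Longrightarrow> \<bar>h' x e\<bar> \<le> C"
    by blast
  have bound: "norm (f n x) \<le> indicator (cball 0 (R + norm e)) x *\<^sub>R C" for n x
  proof (cases "x \<in> cball 0 (R + norm e)")
    case True
    have "\<exists>z. 0 < z \<and> z < t n \<and>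
        h (x + t n *\<^sub>R e) - h (x + 0 *\<^sub>R e) = (t n - 0) * h' (x + z *\<^sub>R e) e"
      by (rule MVT2[OF t(1)]) (rule dl)
    then obtain z where z: "0 < z" "z < t n"
        "h (x + t n *\<^sub>R e) - h (x + 0 *\<^sub>R e) = (t n - 0) * h' (x + z *\<^sub>R e) e"
      by blast
    have "z * norm e \<le> 1 * norm e"
      using z t(2)[of n] by (intro mult_right_mono) auto
    then have "norm (z *\<^sub>R e) \<le> norm e" using z by simp
    then have "x + z *\<^sub>R e \<in> cball 0 (R + 2 * norm e)"
      using True norm_triangle_ineq[of x "z *\<^sub>R e"] unfolding mem_cball_0 by linarith
    then have "\<bar>h' (x + z *\<^sub>R e) e\<bar> \<le> C" by (rule C)
    moreover have "f n x = h' (x + z *\<^sub>R e) e" using z t(1)[of n] by (simp add: f_def)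
    ultimately show ?thesis using True by (simp add: indicator_def)
  next
    case False
    have "t n * norm e \<le> 1 * norm e" using t(2)[of n] by (intro mult_right_mono) auto
    moreover have "norm x \<le> norm (x + t n *\<^sub>R e) + t n * norm e"
      using norm_triangle_ineq4[of "x + t n *\<^sub>R e" "t n *\<^sub>R e"] t(1)[of n] by simp
    ultimately have "x + t n *\<^sub>R e \<notin> cball 0 R" "x \<notin> cball 0 R"
      using False norm_ge_zero[of e] unfolding mem_cball_0 by linarith+
    then show ?thesis using False by (simp add: f_def supp)
  qed
  have "(\<lambda>n. integral\<^sup>L lborel (f n)) \<longlonglongrightarrow> integral\<^sup>L lborel (\<lambda>x. h' x e)"
  proof (rule integral_dominated_convergence[where w = "\<lambda>x. indicator (cball 0 (R + norm e)) x *\<^sub>R C"])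
    show "(\<lambda>x. h' x e) \<in> borel_measurable lborel"
      using c by (simp add: borel_measurable_continuous_onI)
    have "continuous_on UNIV (f n)" for n
      unfolding f_def using t(1)[of n]
      by (intro continuous_intros continuous_on_compose2[OF hc]) auto
    then show "f n \<in> borel_measurable lborel" for n
      by (simp add: borel_measurable_continuous_onI)
    show "integrable lborel (\<lambda>x. indicator (cball 0 (R + norm e)) x *\<^sub>R C)"
      by (intro borel_integrable_compact) auto
  qed (use lim bound in auto)
  then show ?thesis by (simp add: f0 LIMSEQ_const_iff)
qed

text \<open>\<open>U\<close> and the complement of \<open>K\<close> form an open cover; on the
  second set the extension is identically zero.\<close>

lemma continuous_on_indicator_extend:
  fixes g :: "'a::euclidean_space \<Rightarrow> real"
  assumes "open U" "compact K" "K \<subseteq> U" "continuous_on U g" "\<And>x. x \<in> U - K \<Longrightarrow> g x = 0"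
  shows "continuous_on UNIV (\<lambda>x. indicator U x *\<^sub>R g x)"
proof -
  have "continuous_on U (\<lambda>x. indicator U x *\<^sub>R g x)"
    using assms(4) by (rule continuous_on_eq) auto
  moreover have "continuous_on (- K) (\<lambda>x. indicator U x *\<^sub>R g x)"
    by (rule continuous_on_eq[OF continuous_on_const[of _ 0]]) (use assms(5) in \<open>auto simp: indicator_def\<close>)
  moreover have "open (- K)" using assms(2) by (simp add: compact_imp_closed open_Compl)
  ultimately have "continuous_on (U \<union> - K) (\<lambda>x. indicator U x *\<^sub>R g x)"
    using assms(1) by (intro continuous_on_open_Un)
  moreover have "U \<union> - K = UNIV" using assms(3) by auto
  ultimately show ?thesis by simp
qed

text \<open>Translates integrals over \<open>U\<close> for the completed measure into integrals over
  the whole space for \<open>lborel\<close>, where translation invariance is applied.\<close>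

lemma set_integral_indicator_extend:
  fixes g :: "'a::euclidean_space \<Rightarrow> real"
  assumes "open U" "compact K" "K \<subseteq> U" "continuous_on U g" "\<And>x. x \<in> U - K \<Longrightarrow> g x = 0"
  shows "integrable lborel (\<lambda>x. indicator U x *\<^sub>R g x)"
    and "(LINT x:U|lebesgue. g x) = integral\<^sup>L lborel (\<lambda>x. indicator U x *\<^sub>R g x)"
proof -
  have c: "continuous_on UNIV (\<lambda>x. indicator U x *\<^sub>R g x)"
    by (rule continuous_on_indicator_extend[OF assms])
  show "integrable lborel (\<lambda>x. indicator U x *\<^sub>R g x)"
    by (rule integrable_continuous_compact_support[OF assms(2) c])
      (use assms(5) in \<open>auto simp: indicator_def\<close>)
  show "(LINT x:U|lebesgue. g x) = integral\<^sup>L lborel (\<lambda>x. indicator U x *\<^sub>R g x)"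
    unfolding set_lebesgue_integral_def using c
    by (intro integral_completion) (simp add: borel_measurable_continuous_onI)
qed

lemma continuous_on_imp_L2_loc:
  assumes "continuous_on U f"
  shows "f \<in> L2_loc U"
  unfolding L2_loc_def
proof (intro CollectI allI impI)
  fix K assume K: "compact K \<and> K \<subseteq> U"
  then have c: "continuous_on K f" using assms continuous_on_subset by blast
  have Ks: "K \<in> sets lebesgue" using K by (simp add: compact_imp_closed)
  have "integrable lborel (\<lambda>x. indicator K x *\<^sub>R (f x)\<^sup>2)"
    using K c by (intro borel_integrable_compact continuous_intros) auto
  then have "integrable lebesgue (\<lambda>x. indicator K x *\<^sub>R (f x)\<^sup>2)"
    by (simp add: integrable_completion)
  then have "integrable (lebesgue_on K) (\<lambda>x. (f x)\<^sup>2)"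
    using Ks by (simp add: integrable_restrict_space)
  moreover have "f \<in> borel_measurable (lebesgue_on K)"
    using c Ks by (rule continuous_imp_measurable_on_sets_lebesgue)
  ultimately show "f \<in> borel_measurable (lebesgue_on K) \<and> integrable (lebesgue_on K) (\<lambda>x. (f x)\<^sup>2)"
    by simp
qed

text \<open>Integration by parts without boundary: the product of \<open>v\<close> and a test
  function, extended by zero, is differentiable on the whole plane and has compact support, so the
  integral of its directional derivative vanishes.\<close>

lemma classical_imp_weak_gradient:
  fixes v :: "real^2 \<Rightarrow> real" and g :: "real^2 \<Rightarrow> real^2"
  assumes U: "open U" and d: "\<And>x. x \<in> U \<Longrightarrow> (v has_derivative (\<lambda>h. g x \<bullet> h)) (at x)"
    and c: "\<And>i. continuous_on U (\<lambda>x. g x $ i)"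
  shows "has_weak_L2_gradient U v g"
  unfolding has_weak_L2_gradient_def
proof (intro conjI allI impI)
  show "(\<lambda>x. g x $ i) \<in> L2_loc U" for i by (rule continuous_on_imp_L2_loc[OF c])
  fix \<phi> and i :: 2 assume t: "test_function U \<phi>"
  define e :: "real^2" where "e = axis i 1"
  have e: "e \<in> Basis" by (simp add: e_def axis_in_Basis_iff)
  obtain K where K: "compact K" "K \<subseteq> U" "\<And>x. x \<notin> K \<Longrightarrow> \<phi> x = 0"
    using t by (auto simp: test_function_def)
  obtain V g' where "open V" "UNIV \<subseteq> V" "\<And>x. g' x = \<phi> x" "\<And>n. Cn_on n V g'"
    using t by (auto simp: test_function_def smooth_on_def)
  then have "V = UNIV" "g' = \<phi>" by auto
  then have "Cn_on (Suc 0) UNIV \<phi>" using \<open>\<And>n. Cn_on n V g'\<close> by blast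
  then have d\<phi>: "(\<phi> has_derivative frechet_derivative \<phi> (at x)) (at x)"
    and c\<phi>: "continuous_on UNIV (\<lambda>x. frechet_derivative \<phi> (at x) e)" for x
    using e by (auto simp flip: frechet_derivative_works)
  have oK: "open (- K)" using K(1) by (simp add: compact_imp_closed open_Compl)
  have \<phi>0: "frechet_derivative \<phi> (at x) = (\<lambda>h. 0)" if "x \<notin> K" for x
  proof -
    have "(\<phi> has_derivative (\<lambda>h. 0)) (at x)"
      by (rule has_derivative_transform_within_open[OF has_derivative_const[of 0] oK])
        (use that K(3) in auto)
    then show ?thesis using frechet_derivative_at by metis
  qed
  define D1 where "D1 x = v x * frechet_derivative \<phi> (at x) e" for x
  define D2 where "D2 x = g x $ i * \<phi> x" for x
  have cv: "continuous_on U v"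
    by (intro continuous_at_imp_continuous_on ballI has_derivative_continuous[OF d])
  have cphi: "continuous_on UNIV \<phi>"
    by (intro continuous_at_imp_continuous_on ballI has_derivative_continuous[OF d\<phi>])
  have c1: "continuous_on U D1" "continuous_on U D2"
    unfolding D1_def D2_def
    by (intro continuous_intros cv c continuous_on_subset[OF c\<phi>] continuous_on_subset[OF cphi]; simp)+
  have z: "D1 x = 0" "D2 x = 0" if "x \<in> U - K" for x
    using that \<phi>0 K(3) by (auto simp: D1_def D2_def)
  define h where "h x = indicator U x *\<^sub>R (v x * \<phi> x)" for x
  define h' where "h' x = (if x \<in> U then (\<lambda>y. v x * frechet_derivative \<phi> (at x) y + (g x \<bullet> y) * \<phi> x) else (\<lambda>y. 0))" for x
  have dh: "(h has_derivative h' x) (at x)" for x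
  proof (cases "x \<in> U")
    case True
    have "((\<lambda>x. v x * \<phi> x) has_derivative h' x) (at x)"
      using True has_derivative_mult[OF d[OF True] d\<phi>] by (simp add: h'_def)
    then show ?thesis
      by (rule has_derivative_transform_within_open[OF _ U True]) (simp add: h_def)
  next
    case False
    have "(h has_derivative (\<lambda>y. 0)) (at x)"
      by (rule has_derivative_transform_within_open[OF has_derivative_const[of 0] oK])
        (use False K in \<open>auto simp: h_def\<close>)
    then show ?thesis using False by (simp add: h'_def)
  qed
  have h'e: "(\<lambda>x. h' x e) = (\<lambda>x. indicator U x *\<^sub>R D1 x + indicator U x *\<^sub>R D2 x)"
    by (auto simp: h'_def D1_def D2_def fun_eq_iff e_def inner_axis)
  note ex1 = set_integral_indicator_extend[OF U K(1,2) c1(1) z(1)]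
  note ex2 = set_integral_indicator_extend[OF U K(1,2) c1(2) z(2)]
  have ch: "continuous_on UNIV (\<lambda>x. h' x e)"
    unfolding h'e using continuous_on_indicator_extend[OF U K(1,2)] c1 z
    by (intro continuous_on_add) auto
  obtain R where "K \<subseteq> cball 0 R"
    using compact_imp_bounded[OF K(1)] by (auto simp: bounded_iff subset_eq)
  then have "h x = 0" if "x \<notin> cball 0 R" for x
  proof -
    have "x \<notin> K" using that \<open>K \<subseteq> cball 0 R\<close> by blast
    then show ?thesis by (simp add: h_def K(3))
  qed
  then have "integral\<^sup>L lborel (\<lambda>x. h' x e) = 0"
    by (rule integral_directional_derivative_eq_0[OF dh ch])
  moreover have "integral\<^sup>L lborel (\<lambda>x. h' x e)
      = integral\<^sup>L lborel (\<lambda>x. indicator U x *\<^sub>R D1 x) + integral\<^sup>L lborel (\<lambda>x. indicator U x *\<^sub>R D2 x)"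
    unfolding h'e by (rule Bochner_Integration.integral_add[OF ex1(1) ex2(1)])
  moreover have "(LINT x:U|lebesgue. D1 x) = integral\<^sup>L lborel (\<lambda>x. indicator U x *\<^sub>R D1 x)"
    by (rule ex1(2))
  moreover have "(LINT x:U|lebesgue. D2 x) = integral\<^sup>L lborel (\<lambda>x. indicator U x *\<^sub>R D2 x)"
    by (rule ex2(2))
  ultimately have "(LINT x:U|lebesgue. D1 x) + (LINT x:U|lebesgue. D2 x) = 0" by linarith
  then show "(LINT x:U|lebesgue. v x * frechet_derivative \<phi> (at x) (axis i 1)) =
      - (LINT x:U|lebesgue. g x $ i * \<phi> x)"
    by (simp add: D1_def D2_def e_def eq_neg_iff_add_eq_0)
qed

text \<open>A point with (1/2)^(n+1) \<le> norm x < (1/2)^n is accounted for by the n-th term. At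
  the origin the left side is 0 by the convention 0 powr \<gamma> = 0.\<close>

lemma norm_powr_le_dyadic_sum:
  fixes x :: "'a::euclidean_space"
  assumes \<gamma>: "\<gamma> \<le> 0"
  shows "ennreal (indicator (ball 0 1) x * norm x powr \<gamma>)
    \<le> (\<Sum>n. ennreal (2 powr (- \<gamma> * real (Suc n))) * indicator (ball 0 ((1/2) ^ n)) x)"
proof (cases "x \<in> ball 0 1 - {0}")
  case True
  then have x: "0 < norm x" "norm x < 1" by auto
  obtain m where "(1/2) ^ m < norm x" using real_arch_pow_inv[OF x(1), of "1/2"] by auto
  then have ex: "\<exists>m. (1/2) ^ m \<le> norm x" using less_imp_le by blast
  define l where "l = (LEAST m. (1/2) ^ m \<le> norm x)"
  have l: "(1/2) ^ l \<le> norm x" unfolding l_def using ex by (rule LeastI_ex)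
  then have "l \<noteq> 0" using x by (intro notI) simp
  then obtain n where n: "l = Suc n" using not0_implies_Suc by blast
  have "\<not> (1/2) ^ n \<le> norm x" using not_less_Least[of n "\<lambda>m. (1/2) ^ m \<le> norm x"] n l_def by simp
  then have xn: "x \<in> ball 0 ((1/2) ^ n)" by simp
  have "norm x powr \<gamma> \<le> ((1/2) ^ Suc n) powr \<gamma>"
    using l n \<gamma> by (intro powr_mono2') auto
  also have "(1/2::real) ^ Suc n = 2 powr (- real (Suc n))"
    by (simp only: powr_minus powr_realpow power_one_over inverse_eq_divide zero_less_numeral)
  also have "(2 powr (- real (Suc n))) powr \<gamma> = 2 powr (- \<gamma> * real (Suc n))"
    by (simp add: powr_powr algebra_simps)
  finally have "ennreal (indicator (ball 0 1) x * norm x powr \<gamma>)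
    \<le> ennreal (2 powr (- \<gamma> * real (Suc n))) * indicator (ball 0 ((1/2) ^ n)) x"
    using True xn by (simp add: ennreal_leI)
  also have "\<dots> \<le> (\<Sum>n. ennreal (2 powr (- \<gamma> * real (Suc n))) * indicator (ball 0 ((1/2) ^ n)) x)"
    using sum_le_suminf[OF summableI, of "{n}"] by simp
  finally show ?thesis .
qed auto

text \<open>The n-th dyadic ball contributes a multiple of (2 powr (- \<gamma>) / 4) ^ n, the 4
  being the scaling of area; the ratio is below 1 exactly when \<gamma> > -2. Positive exponents are
  compared with exponent 0.\<close>

lemma set_integrable_norm_powr:
  assumes \<gamma>: "\<gamma> > -2"
  shows "set_integrable lborel (ball 0 1) (\<lambda>x::real^2. norm x powr \<gamma>)"
proof -
  have meas: "(\<lambda>x::real^2. indicator (ball 0 1) x *\<^sub>R norm x powr \<gamma>) \<in> borel_measurable lborel" for \<gamma>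
  proof -
    have "(\<lambda>x::real^2. indicator (ball 0 1 - {0}) x *\<^sub>R norm x powr \<gamma>) \<in> borel_measurable borel"
      by (intro borel_measurable_continuous_on_indicator continuous_on_powr continuous_intros) auto
    moreover have "(\<lambda>x::real^2. indicator (ball 0 1 - {0}) x *\<^sub>R norm x powr \<gamma>)
        = (\<lambda>x. indicator (ball 0 1) x *\<^sub>R norm x powr \<gamma>)"
      by (auto simp: indicator_def fun_eq_iff)
    ultimately show ?thesis unfolding measurable_lborel1 by simp
  qed
  have base: "set_integrable lborel (ball 0 1) (\<lambda>x::real^2. norm x powr \<gamma>)" if \<gamma>: "\<gamma> > -2" "\<gamma> \<le> 0" for \<gamma>
    unfolding set_integrable_def
  proof (rule integrableI_nonneg)
    show "AE x::real^2 in lborel. 0 \<le> indicator (ball 0 1) x *\<^sub>R norm x powr \<gamma>" by simp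
    show "(\<lambda>x::real^2. indicator (ball 0 1) x *\<^sub>R norm x powr \<gamma>) \<in> borel_measurable lborel" by (rule meas)
    define X where "X = 2 powr (- \<gamma>)"
    define z where "z = X / 4"
    have z: "0 < z" "z < 1"
    proof -
      have "2 powr (- \<gamma>) < 2 powr 2" using \<gamma> by (intro powr_less_mono) auto
      then show "0 < z" "z < 1" by (auto simp: z_def X_def)
    qed
    define V where "V = X * unit_ball_vol 2"
    have V: "0 \<le> V" by (simp add: V_def X_def)
    have "(\<integral>\<^sup>+ x. ennreal (indicator (ball (0::real^2) 1) x *\<^sub>R norm x powr \<gamma>) \<partial>lborel)
      \<le> (\<integral>\<^sup>+ x. (\<Sum>n. ennreal (2 powr (- \<gamma> * real (Suc n))) * indicator (ball (0::real^2) ((1/2) ^ n)) x) \<partial>lborel)"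
      unfolding real_scaleR_def by (intro nn_integral_mono norm_powr_le_dyadic_sum[OF \<gamma>(2)])
    also have "\<dots> = (\<Sum>n. \<integral>\<^sup>+ x. ennreal (2 powr (- \<gamma> * real (Suc n))) * indicator (ball (0::real^2) ((1/2) ^ n)) x \<partial>lborel)"
      by (intro nn_integral_suminf borel_measurable_times_ennreal borel_measurable_const
          borel_measurable_indicator) simp
    also have "\<dots> = (\<Sum>n. ennreal (V * z ^ n))"
    proof (rule arg_cong[where f = suminf], rule ext)
      fix n
      have "(\<integral>\<^sup>+ x. ennreal (2 powr (- \<gamma> * real (Suc n))) * indicator (ball (0::real^2) ((1/2) ^ n)) x \<partial>lborel)
        = ennreal (2 powr (- \<gamma> * real (Suc n))) * emeasure lborel (ball (0::real^2) ((1/2) ^ n))"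
        by (rule nn_integral_cmult_indicator) simp
      also have "\<dots> = ennreal (2 powr (- \<gamma> * real (Suc n)) * (unit_ball_vol 2 * ((1/2) ^ n)\<^sup>2))"
        by (simp add: emeasure_ball ennreal_mult)
      also have "\<dots> = ennreal (V * z ^ n)"
      proof -
        have "2 powr (- \<gamma> * real (Suc n)) = (2 powr (- \<gamma>)) powr real (Suc n)"
          by (simp only: powr_powr)
        also have "\<dots> = X ^ Suc n" unfolding X_def by (rule powr_realpow) simp
        finally have 1: "2 powr (- \<gamma> * real (Suc n)) = X ^ Suc n" .
        have "((1/2::real) ^ n)\<^sup>2 = ((1/2)\<^sup>2) ^ n"
          by (simp only: power_mult[symmetric] mult.commute[of n])
        also have "(1/2::real)\<^sup>2 = 1/4" by (simp add: power2_eq_square)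
        finally show ?thesis unfolding 1 by (simp add: V_def z_def power_divide mult_ac)
      qed
      finally show "(\<integral>\<^sup>+ x. ennreal (2 powr (- \<gamma> * real (Suc n))) * indicator (ball (0::real^2) ((1/2) ^ n)) x \<partial>lborel)
        = ennreal (V * z ^ n)" .
    qed
    also have "\<dots> = ennreal (\<Sum>n. V * z ^ n)"
      using z V by (intro suminf_ennreal2 summable_mult summable_geometric) auto
    also have "\<dots> < \<infinity>" by simp
    finally show "(\<integral>\<^sup>+ x. ennreal (indicator (ball (0::real^2) 1) x *\<^sub>R norm x powr \<gamma>) \<partial>lborel) < \<infinity>" .
  qed
  have "set_integrable lborel (ball 0 1) (\<lambda>x::real^2. norm x powr min \<gamma> 0)"
    using \<gamma> by (intro base) auto
  then show ?thesis
    unfolding set_integrable_def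
  proof (rule Bochner_Integration.integrable_bound)
    show "(\<lambda>x::real^2. indicator (ball 0 1) x *\<^sub>R norm x powr \<gamma>) \<in> borel_measurable lborel" by (rule meas)
    have "norm x powr \<gamma> \<le> norm x powr min \<gamma> 0" if "norm x < 1" for x :: "real^2"
      using that by (cases "x = 0") (auto intro!: powr_mono')
    then show "AE x::real^2 in lborel. norm (indicator (ball 0 1) x *\<^sub>R norm x powr \<gamma>)
        \<le> norm (indicator (ball 0 1) x *\<^sub>R norm x powr min \<gamma> 0)"
      by (auto simp: indicator_def)
  qed
qed

subsection \<open>Homogeneous functions in the plane\<close>

lemma periodic_int_multiple:
  fixes f :: "real \<Rightarrow> 'a" and n :: int
  assumes "\<And>t. f (t + T) = f t"
  shows "f (t + of_int n * T) = f t"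
proof -
  have nat: "f (t + real m * T) = f t" for t m
  proof (induction m)
    case (Suc m)
    have "f (t + real (Suc m) * T) = f ((t + real m * T) + T)" by (simp add: algebra_simps)
    then show ?case using Suc assms by simp
  qed simp
  show ?thesis
  proof (cases "n \<ge> 0")
    case True
    then show ?thesis using nat[of t "nat n"] by simp
  next
    case False
    then show ?thesis using nat[of "t + of_int n * T" "nat (- n)"] by simp
  qed
qed

lemma polar_nth [simp]: "polar r t $ 1 = r * cos t" "polar r t $ 2 = r * sin t"
  by (simp_all add: polar_def)

lemma norm_sq_2: "(norm x)\<^sup>2 = (x $ 1)\<^sup>2 + (x $ 2)\<^sup>2" for x :: "real^2"
  unfolding power2_norm_eq_inner inner_vec_def sum_2 by (simp add: power2_eq_square)

lemma norm_polar [simp]: "norm (polar r t) = \<bar>r\<bar>"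
proof -
  have "(norm (polar r t))\<^sup>2 = r\<^sup>2 * ((sin t)\<^sup>2 + (cos t)\<^sup>2)"
    unfolding norm_sq_2 polar_nth by algebra
  then have "(norm (polar r t))\<^sup>2 = \<bar>r\<bar>\<^sup>2" by simp
  then show ?thesis by (simp only: power2_eq_iff_nonneg norm_ge_zero abs_ge_zero)
qed

lemma polar_exists:
  fixes x :: "real^2"
  shows "\<exists>t. x = polar (norm x) t"
proof (cases "x = 0")
  case True
  then have "x = polar (norm x) 0" by (simp add: vec_eq_iff forall_2)
  then show ?thesis ..
next
  case False
  then have nz: "norm x \<noteq> 0" by simp
  have "(x $ 1 / norm x)\<^sup>2 + (x $ 2 / norm x)\<^sup>2 = ((x $ 1)\<^sup>2 + (x $ 2)\<^sup>2) / (norm x)\<^sup>2"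
    unfolding power_divide add_divide_distrib ..
  also have "\<dots> = 1" using nz by (simp flip: norm_sq_2)
  finally obtain t where "x $ 1 / norm x = cos t" "x $ 2 / norm x = sin t"
    using sincos_total_2pi by metis
  then have "x $ 1 = norm x * cos t" "x $ 2 = norm x * sin t"
    using nz by (auto simp: field_simps)
  then have "x = polar (norm x) t"
    unfolding vec_eq_iff forall_2 polar_nth by (rule conjI)
  then show ?thesis ..
qed

text \<open>An arbitrary, in general discontinuous choice of the argument. This is harmless because
  every result about \<open>homogeneous\<close> below assumes a profile of period 2 pi.\<close>

definition angle :: "real^2 \<Rightarrow> real" where
  "angle x = (SOME t. x = polar (norm x) t)"

lemma polar_angle: "polar (norm x) (angle x) = x"
  unfolding angle_def using someI_ex[OF polar_exists[of x]] by simp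

text \<open>At the origin the value is 0 for every \<mu>, again by the convention for
  \<open>powr\<close>.\<close>

definition homogeneous :: "real \<Rightarrow> (real \<Rightarrow> real) \<Rightarrow> real^2 \<Rightarrow> real" where
  "homogeneous \<mu> \<psi> x = norm x powr \<mu> * \<psi> (angle x)"

lemma homogeneous_polar:
  assumes "\<And>t. \<psi> (t + 2 * pi) = \<psi> t" "r > 0"
  shows "homogeneous \<mu> \<psi> (polar r t) = r powr \<mu> * \<psi> t"
proof -
  define s where "s = angle (polar r t)"
  have "polar r s = polar r t" using polar_angle[of "polar r t"] assms(2) by (simp add: s_def)
  then have "polar r s $ 1 = polar r t $ 1" "polar r s $ 2 = polar r t $ 2" by simp_all
  then have "sin s = sin t \<and> cos s = cos t" using assms(2) by simp
  then obtain n :: int where "s = t + 2 * pi * of_int n" using sin_cos_eq_iff[of s t] by blast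
  then have "\<psi> s = \<psi> t" using periodic_int_multiple[of \<psi> "2 * pi" t n] assms(1) by (simp add: mult_ac)
  then show ?thesis using assms(2) by (simp add: homogeneous_def flip: s_def)
qed

text \<open>\<open>partial1\<close> and \<open>partial2\<close> are the angular profiles of the two
  Cartesian partial derivatives of r powr \<mu> * \<psi>; both derivatives are homogeneous of degree
  \<mu> - 1.\<close>

definition partial1 :: "real \<Rightarrow> (real \<Rightarrow> real) \<Rightarrow> (real \<Rightarrow> real) \<Rightarrow> real \<Rightarrow> real" where
  "partial1 \<mu> \<psi> \<psi>' t = \<mu> * cos t * \<psi> t - sin t * \<psi>' t"

definition partial2 :: "real \<Rightarrow> (real \<Rightarrow> real) \<Rightarrow> (real \<Rightarrow> real) \<Rightarrow> real \<Rightarrow> real" where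
  "partial2 \<mu> \<psi> \<psi>' t = \<mu> * sin t * \<psi> t + cos t * \<psi>' t"

text \<open>Since \<open>angle\<close> may jump, it is replaced near x by the smooth branch t +
  arctan (u / w) on a half-plane containing x; by periodicity the function is unchanged
  there.\<close>

lemma homogeneous_has_derivative:
  assumes per: "\<And>t. \<psi> (t + 2 * pi) = \<psi> t"
    and d: "\<And>t. (\<psi> has_real_derivative \<psi>' t) (at t)" and x: "x \<noteq> 0"
  shows "(homogeneous \<mu> \<psi> has_derivative
    (\<lambda>h. homogeneous (\<mu> - 1) (partial1 \<mu> \<psi> \<psi>') x * h $ 1
       + homogeneous (\<mu> - 1) (partial2 \<mu> \<psi> \<psi>') x * h $ 2)) (at x)"
proof -
  define r where "r = norm x"
  define t where "t = angle x"
  define c where "c = cos t"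
  define s where "s = sin t"
  have cs: "c\<^sup>2 + s\<^sup>2 = 1" by (simp add: c_def s_def)
  have r: "r > 0" using x by (simp add: r_def)
  have xp: "x = polar r t" using polar_angle[of x] by (simp add: r_def t_def)
  have x12: "x $ 1 = r * c" "x $ 2 = r * s" by (simp_all add: xp c_def s_def)
  \<comment> \<open>\<open>w\<close> and \<open>u\<close> are the coordinates in the frame rotated
    to the direction of x, so that \<open>u x = 0\<close> and the angle measured from x is arctan (u
    / w).\<close>
  define u where "u y = y $ 2 * c - y $ 1 * s" for y :: "real^2"
  define w where "w y = y $ 1 * c + y $ 2 * s" for y :: "real^2"
  define W where "W = {y. 0 < w y}"
  have wx: "w x = r" "u x = 0" unfolding w_def u_def x12 using cs by (algebra, simp)
  have W: "open W" "x \<in> W"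
    unfolding W_def using wx(1) r by (auto intro!: open_Collect_less continuous_intros simp: w_def)
  define \<Theta> where "\<Theta> y = t + arctan (u y / w y)" for y
  define f where "f y = ((y $ 1)\<^sup>2 + (y $ 2)\<^sup>2) powr (\<mu> / 2) * \<psi> (\<Theta> y)" for y :: "real^2"
  have f: "f y = homogeneous \<mu> \<psi> y" if "y \<in> W" for y
  proof -
    have wy: "w y > 0" using that by (simp add: W_def)
    have uw: "(u y)\<^sup>2 + (w y)\<^sup>2 = (norm y)\<^sup>2"
    proof -
      have "(u y)\<^sup>2 + (w y)\<^sup>2 = ((y $ 1)\<^sup>2 + (y $ 2)\<^sup>2) * (c\<^sup>2 + s\<^sup>2)"
        unfolding u_def w_def by algebra
      then show ?thesis unfolding cs norm_sq_2 by simp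
    qed
    define b where "b = arctan (u y / w y)"
    have cb: "cos b = w y / norm y" "sin b = u y / norm y"
    proof -
      have "1 + (u y / w y)\<^sup>2 = (norm y)\<^sup>2 / (w y)\<^sup>2"
        using wy uw by (simp add: field_simps)
      then have q: "sqrt (1 + (u y / w y)\<^sup>2) = norm y / w y"
        using wy by (simp add: real_sqrt_divide)
      show "cos b = w y / norm y" "sin b = u y / norm y"
        unfolding b_def cos_arctan sin_arctan q using wy by auto
    qed
    have y0: "norm y \<noteq> 0" using wy uw by auto
    have "y = polar (norm y) (\<Theta> y)"
    proof -
      have "norm y * cos (t + b) = w y * c - u y * s"
        using y0 unfolding cos_add cb c_def s_def by (simp add: right_diff_distrib mult_ac)
      moreover have "w y * c - u y * s = y $ 1 * (c\<^sup>2 + s\<^sup>2)" unfolding w_def u_def by algebra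
      moreover have "norm y * sin (t + b) = u y * c + w y * s"
        using y0 unfolding sin_add cb c_def s_def by (simp add: distrib_left mult_ac)
      moreover have "u y * c + w y * s = y $ 2 * (c\<^sup>2 + s\<^sup>2)" unfolding w_def u_def by algebra
      ultimately show ?thesis unfolding \<Theta>_def b_def[symmetric] cs by (simp add: vec_eq_iff forall_2)
    qed
    then have "homogeneous \<mu> \<psi> y = norm y powr \<mu> * \<psi> (\<Theta> y)"
      using homogeneous_polar[of \<psi> "norm y" \<mu> "\<Theta> y", OF per] y0 by simp
    also have "norm y powr \<mu> = ((norm y)\<^sup>2) powr (\<mu> / 2)"
      using y0 by (simp add: powr_powr flip: powr_numeral)
    finally show ?thesis unfolding f_def norm_sq_2 by simp
  qed
  have nth: "((\<lambda>y::real^2. y $ i) has_derivative (\<lambda>h. h $ i)) (at x)" for i x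
    by (rule bounded_linear_imp_has_derivative[OF bounded_linear_vec_nth])
  have du: "(u has_derivative (\<lambda>h. h $ 2 * c - h $ 1 * s)) (at x)"
    unfolding u_def by (auto intro!: derivative_eq_intros nth)
  have dw: "(w has_derivative (\<lambda>h. h $ 1 * c + h $ 2 * s)) (at x)"
    unfolding w_def by (auto intro!: derivative_eq_intros nth)
  have d\<Theta>: "(\<Theta> has_derivative (\<lambda>h. (h $ 2 * c - h $ 1 * s) / r)) (at x)"
  proof -
    have "((\<lambda>y. u y / w y) has_derivative (\<lambda>h. (h $ 2 * c - h $ 1 * s) / r)) (at x)"
      using has_derivative_divide[OF du dw] wx r by (simp add: divide_inverse)
    moreover have "(arctan has_real_derivative 1) (at (u x / w x))"
      using DERIV_arctan[of 0] wx by simp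
    ultimately have "((\<lambda>y. arctan (u y / w y)) has_derivative (\<lambda>h. 1 * ((h $ 2 * c - h $ 1 * s) / r))) (at x)"
      unfolding has_field_derivative_def by (rule has_derivative_compose)
    from has_derivative_add[OF has_derivative_const[of t] this]
    show ?thesis unfolding \<Theta>_def by simp
  qed
  have d\<psi>: "((\<lambda>y. \<psi> (\<Theta> y)) has_derivative (\<lambda>h. \<psi>' t * ((h $ 2 * c - h $ 1 * s) / r))) (at x)"
  proof -
    have "\<Theta> x = t" by (simp add: \<Theta>_def wx)
    then have "(\<psi> has_derivative (\<lambda>h. \<psi>' t * h)) (at (\<Theta> x))" using d[of t] by (simp add: has_field_derivative_def)
    from has_derivative_compose[OF d\<Theta> this] show ?thesis .
  qed
  have dn: "((\<lambda>y::real^2. ((y $ 1)\<^sup>2 + (y $ 2)\<^sup>2) powr (\<mu> / 2)) has_derivative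
      (\<lambda>h. \<mu> * r powr (\<mu> - 1) * (c * h $ 1 + s * h $ 2))) (at x)"
  proof -
    have n2: "(x $ 1)\<^sup>2 + (x $ 2)\<^sup>2 = r\<^sup>2" unfolding r_def norm_sq_2 ..
    have p: "((\<lambda>z. z powr (\<mu> / 2)) has_real_derivative \<mu> / 2 * (r\<^sup>2) powr (\<mu> / 2 - 1))
        (at ((x $ 1)\<^sup>2 + (x $ 2)\<^sup>2))"
      unfolding n2 using has_real_derivative_powr[of "r\<^sup>2" "\<mu> / 2"] r by simp
    have q: "((\<lambda>y::real^2. (y $ 1)\<^sup>2 + (y $ 2)\<^sup>2) has_derivative (\<lambda>h. 2 * r * (c * h $ 1 + s * h $ 2))) (at x)"
      by (auto intro!: derivative_eq_intros nth simp: x12 algebra_simps)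
    have "(r\<^sup>2) powr (\<mu> / 2 - 1) = r powr (\<mu> - 2)"
      using r by (simp add: powr_powr algebra_simps flip: powr_numeral)
    then have "(r\<^sup>2) powr (\<mu> / 2 - 1) * r = r powr (\<mu> - 1)"
      using r powr_add[of r "\<mu> - 2" 1] by simp
    then have "(\<lambda>h::real^2. (\<mu> / 2 * (r\<^sup>2) powr (\<mu> / 2 - 1)) * (2 * r * (c * h $ 1 + s * h $ 2)))
       = (\<lambda>h. \<mu> * r powr (\<mu> - 1) * (c * h $ 1 + s * h $ 2))"
      by (auto simp: fun_eq_iff)
    with has_derivative_compose[OF q p[unfolded has_field_derivative_def]] show ?thesis by simp
  qed
  have h1: "homogeneous (\<mu> - 1) (partial1 \<mu> \<psi> \<psi>') x = r powr (\<mu> - 1) * (\<mu> * c * \<psi> t - s * \<psi>' t)"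
    by (simp add: homogeneous_def partial1_def r_def t_def c_def s_def)
  have h2: "homogeneous (\<mu> - 1) (partial2 \<mu> \<psi> \<psi>') x = r powr (\<mu> - 1) * (\<mu> * s * \<psi> t + c * \<psi>' t)"
    by (simp add: homogeneous_def partial2_def r_def t_def c_def s_def)
  have rr: "r powr \<mu> / r = r powr (\<mu> - 1)" using r by (simp add: powr_diff)
  have n2: "((x $ 1)\<^sup>2 + (x $ 2)\<^sup>2) powr (\<mu> / 2) = r powr \<mu>"
    unfolding norm_sq_2[symmetric] r_def[symmetric] using r by (simp add: powr_powr flip: powr_numeral)
  have \<Theta>x: "\<Theta> x = t" by (simp add: \<Theta>_def wx)
  have eq: "(\<lambda>h::real^2. r powr \<mu> * (\<psi>' t * ((h $ 2 * c - h $ 1 * s) / r))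
      + \<mu> * r powr (\<mu> - 1) * (c * h $ 1 + s * h $ 2) * \<psi> t)
    = (\<lambda>h. homogeneous (\<mu> - 1) (partial1 \<mu> \<psi> \<psi>') x * h $ 1
       + homogeneous (\<mu> - 1) (partial2 \<mu> \<psi> \<psi>') x * h $ 2)"
    unfolding h1 h2 rr[symmetric] by (rule ext) (simp add: algebra_simps diff_divide_distrib add_divide_distrib)
  have "(f has_derivative (\<lambda>h. homogeneous (\<mu> - 1) (partial1 \<mu> \<psi> \<psi>') x * h $ 1
       + homogeneous (\<mu> - 1) (partial2 \<mu> \<psi> \<psi>') x * h $ 2)) (at x)"
    using has_derivative_mult[OF dn d\<psi>] unfolding f_def n2 \<Theta>x eq .
  then show ?thesis by (rule has_derivative_transform_within_open[OF _ W f])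
qed

lemma periodic_deriv:
  fixes \<psi> :: "real \<Rightarrow> real"
  assumes "\<And>t. \<psi> (t + T) = \<psi> t" "\<And>t. (\<psi> has_real_derivative \<psi>' t) (at t)"
  shows "\<psi>' (t + T) = \<psi>' t"
proof -
  have "((\<lambda>t. \<psi> (t + T)) has_real_derivative \<psi>' (t + T)) (at t)"
    using DERIV_shift assms(2) by blast
  then show ?thesis using assms DERIV_unique[of \<psi> _ t] by simp
qed

lemma partial_periodic:
  assumes "\<And>t. \<psi> (t + 2 * pi) = \<psi> t" "\<And>t. \<psi>' (t + 2 * pi) = \<psi>' t"
  shows "partial1 \<mu> \<psi> \<psi>' (t + 2 * pi) = partial1 \<mu> \<psi> \<psi>' t"
    and "partial2 \<mu> \<psi> \<psi>' (t + 2 * pi) = partial2 \<mu> \<psi> \<psi>' t"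
  by (simp_all add: partial1_def partial2_def assms)

lemma Cn_on_partial:
  assumes "Cn_on n UNIV \<psi>" "Cn_on n UNIV \<psi>'"
  shows "Cn_on n UNIV (partial1 \<mu> \<psi> \<psi>')" "Cn_on n UNIV (partial2 \<mu> \<psi> \<psi>')"
proof -
  have id: "Cn_on n UNIV (\<lambda>t::real. t)"
    by (cases n) (auto intro!: Cn_on_Suc_realI[where f' = "\<lambda>_. 1"] Cn_on_const)
  have sc: "Cn_on n UNIV (\<lambda>t. sin t)" "Cn_on n UNIV (\<lambda>t::real. cos t)"
    using Cn_on_sin_cos[OF id] by auto
  have "Cn_on n UNIV (\<lambda>t. \<mu> * cos t * \<psi> t + - (sin t * \<psi>' t))"
    "Cn_on n UNIV (\<lambda>t. \<mu> * sin t * \<psi> t + cos t * \<psi>' t)"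
    by (intro Cn_on_add Cn_on_mult Cn_on_minus Cn_on_const sc assms)+
  then show "Cn_on n UNIV (partial1 \<mu> \<psi> \<psi>')" "Cn_on n UNIV (partial2 \<mu> \<psi> \<psi>')"
    by (simp_all add: partial1_def[abs_def] partial2_def[abs_def])
qed

text \<open>Homogeneous functions with smooth periodic profile are closed under partial derivatives,
  so the induction lets both the degree and the profile vary.\<close>

lemma Cn_on_homogeneous:
  assumes "\<And>t. \<psi> (t + 2 * pi) = \<psi> t" "\<And>n. Cn_on n UNIV \<psi>"
  shows "Cn_on n (- {0}) (homogeneous \<mu> \<psi>)"
  using assms
proof (induction n arbitrary: \<mu> \<psi>)
  case 0
  obtain \<psi>' where d: "\<And>t. (\<psi> has_real_derivative \<psi>' t) (at t)"
    using Cn_on_Suc_realE[OF "0.prems"(2)[of "Suc 0"]] by blast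
  show ?case unfolding Cn_on.simps
    by (intro continuous_at_imp_continuous_on ballI
      has_derivative_continuous[OF homogeneous_has_derivative[OF "0.prems"(1) d]]) auto
next
  case (Suc n)
  obtain \<psi>' where d: "\<And>t. (\<psi> has_real_derivative \<psi>' t) (at t)"
    using Cn_on_Suc_realE[OF Suc.prems(2)[of "Suc 0"]] by blast
  have c': "Cn_on n UNIV \<psi>'" for n using Cn_on_real_deriv[OF Suc.prems(2) d] .
  note per = partial_periodic[of \<psi> \<psi>', OF Suc.prems(1) periodic_deriv[OF Suc.prems(1) d]]
  have IH: "Cn_on n (- {0}) (homogeneous (\<mu> - 1) (partial1 \<mu> \<psi> \<psi>'))"
    "Cn_on n (- {0}) (homogeneous (\<mu> - 1) (partial2 \<mu> \<psi> \<psi>'))"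
    by (intro Suc.IH per Cn_on_partial Suc.prems(2) c')+
  show ?case
  proof (rule Cn_on_SucI)
    show "(homogeneous \<mu> \<psi> has_derivative
      (\<lambda>h. homogeneous (\<mu> - 1) (partial1 \<mu> \<psi> \<psi>') x * h $ 1
       + homogeneous (\<mu> - 1) (partial2 \<mu> \<psi> \<psi>') x * h $ 2)) (at x)" if "x \<in> - {0}" for x
      by (rule homogeneous_has_derivative[OF Suc.prems(1) d]) (use that in auto)
    fix b :: "real^2" assume "b \<in> Basis"
    then obtain i where "b = axis i 1" by (auto simp: Basis_vec_def)
    then have "b = axis 1 1 \<or> b = axis 2 1" using exhaust_2[of i] by auto
    then show "Cn_on n (- {0}) (\<lambda>x. homogeneous (\<mu> - 1) (partial1 \<mu> \<psi> \<psi>') x * b $ 1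
       + homogeneous (\<mu> - 1) (partial2 \<mu> \<psi> \<psi>') x * b $ 2)"
      using IH by (auto simp: axis_def)
  qed auto
qed

text \<open>On the unit circle the degree drops out, so one bound of the profile, obtained by
  compactness, serves all degrees at once.\<close>

lemma homogeneous_bound:
  assumes "\<And>t. \<psi> (t + 2 * pi) = \<psi> t" "\<And>n. Cn_on n UNIV \<psi>"
  obtains M where "\<And>\<mu> x. (homogeneous \<mu> \<psi> x)\<^sup>2 \<le> M * norm x powr (2 * \<mu>)" "M \<ge> 0"
proof -
  have "continuous_on (- {0}) (homogeneous 0 \<psi>)"
    using Cn_on_homogeneous[OF assms, where n = 0 and \<mu> = 0] by simp
  then have "continuous_on (sphere 0 1) (homogeneous 0 \<psi>)"
    by (rule continuous_on_subset) auto
  then have "bounded (homogeneous 0 \<psi> ` sphere 0 1)"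
    by (intro compact_imp_bounded compact_continuous_image) auto
  then obtain B where B: "\<And>x. norm x = 1 \<Longrightarrow> \<bar>homogeneous 0 \<psi> x\<bar> \<le> B"
    unfolding bounded_iff by (metis imageI mem_sphere_0 real_norm_def)
  have psi: "(\<psi> t)\<^sup>2 \<le> B\<^sup>2" for t
    using B[of "polar 1 t"] homogeneous_polar[of \<psi> 1 0 t, OF assms(1)]
    by (simp add: abs_le_square_iff[symmetric])
  have "(homogeneous \<mu> \<psi> x)\<^sup>2 \<le> B\<^sup>2 * norm x powr (2 * \<mu>)" for \<mu> x
  proof -
    have "(norm x powr \<mu>)\<^sup>2 = norm x powr (2 * \<mu>)"
      by (simp add: power2_eq_square flip: powr_add)
    then show ?thesis
      unfolding homogeneous_def power_mult_distrib
      using mult_right_mono[OF psi[of "angle x"], of "norm x powr (2 * \<mu>)"] by (simp add: mult.commute)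
  qed
  then show ?thesis using that by (meson zero_le_power2)
qed

lemma frame_components_norm:
  fixes g x :: "real^2"
  assumes "x \<noteq> 0"
  shows "(g \<bullet> e_r x)\<^sup>2 + (g \<bullet> e_\<theta> x)\<^sup>2 = (g $ 1)\<^sup>2 + (g $ 2)\<^sup>2"
proof -
  define n where "n = 1 / norm x"
  have n: "n\<^sup>2 * ((x $ 1)\<^sup>2 + (x $ 2)\<^sup>2) = 1"
    using assms unfolding norm_sq_2[symmetric] n_def by (simp add: power_divide)
  have e: "g \<bullet> e_r x = n * (g $ 1 * x $ 1 + g $ 2 * x $ 2)"
    "g \<bullet> e_\<theta> x = n * (g $ 2 * x $ 1 - g $ 1 * x $ 2)"
    unfolding e_r_def e_\<theta>_def n_def[symmetric] inner_vec_def sum_2 by (simp_all add: algebra_simps)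
  have "(g \<bullet> e_r x)\<^sup>2 + (g \<bullet> e_\<theta> x)\<^sup>2
     = (n\<^sup>2 * ((x $ 1)\<^sup>2 + (x $ 2)\<^sup>2)) * ((g $ 1)\<^sup>2 + (g $ 2)\<^sup>2)"
    unfolding e by algebra
  then show ?thesis unfolding n by simp
qed

text \<open>The two parts of the integrand are bounded by powers of the norm with exponents 2 \<mu>
  + 2 \<beta> and 2 (\<mu> - 1) + 2 \<alpha>. The conditions \<open>w\<close> say that both exceed
  -2, the threshold of integrability at the origin of the plane.\<close>

lemma homogeneous_in_Y1:
  assumes per: "\<And>t. \<psi> (t + 2 * pi) = \<psi> t" and perN: "\<And>t. \<psi> (t + 2 * pi / real N) = \<psi> t"
    and sm: "\<And>n. Cn_on n UNIV \<psi>"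
    and w: "\<mu> + \<beta> > -1" "\<mu> + \<alpha> > 0"
  shows "homogeneous \<mu> \<psi> \<in> Y1 N \<alpha> \<beta>"
proof -
  let ?v = "homogeneous \<mu> \<psi>"
  obtain \<psi>' where d: "\<And>t. (\<psi> has_real_derivative \<psi>' t) (at t)"
    using Cn_on_Suc_realE[OF sm[of "Suc 0"]] by blast
  have sm': "Cn_on n UNIV \<psi>'" for n using Cn_on_real_deriv[OF sm d] .
  note perp = partial_periodic[of \<psi> \<psi>', OF per periodic_deriv[OF per d]]
  note smp = Cn_on_partial[OF sm sm']
  define g1 where "g1 = homogeneous (\<mu> - 1) (partial1 \<mu> \<psi> \<psi>')"
  define g2 where "g2 = homogeneous (\<mu> - 1) (partial2 \<mu> \<psi> \<psi>')"
  define g :: "real^2 \<Rightarrow> real^2" where "g x = vector [g1 x, g2 x]" for x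
  have dv: "(?v has_derivative (\<lambda>h. g x \<bullet> h)) (at x)" if "x \<noteq> 0" for x
    using homogeneous_has_derivative[OF per d that, where \<mu> = \<mu>]
    unfolding g_def inner_vec_def sum_2 g1_def g2_def by simp
  have cv: "continuous_on (- {0}) ?v"
    using Cn_on_homogeneous[OF per sm, where n = 0] by simp
  have cg: "continuous_on (- {0}) g1" "continuous_on (- {0}) g2"
    unfolding g1_def g2_def
    using Cn_on_homogeneous[OF perp(1) smp(1), where n = 0]
      Cn_on_homogeneous[OF perp(2) smp(2), where n = 0] by simp_all
  have PD: "punctured_disc \<subseteq> - {0}" "open punctured_disc"
    by (auto simp: punctured_disc_def)
  have cgi: "continuous_on punctured_disc (\<lambda>x. g x $ i)" for i
  proof -
    have "(\<lambda>x. g x $ i) = g1 \<or> (\<lambda>x. g x $ i) = g2"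
      using exhaust_2[of i] by (auto simp: g_def)
    then show ?thesis
      using continuous_on_subset[OF cg(1) PD(1)] continuous_on_subset[OF cg(2) PD(1)] by metis
  qed
  have weak: "has_weak_L2_gradient punctured_disc ?v g"
    by (rule classical_imp_weak_gradient[OF PD(2) dv cgi]) (use PD in auto)
  have "?v \<in> L2_loc punctured_disc"
    by (rule continuous_on_imp_L2_loc[OF continuous_on_subset[OF cv PD(1)]])
  then have W: "?v \<in> W12_loc punctured_disc" using weak by (auto simp: W12_loc_def)
  define J where "J x = (?v x)\<^sup>2 * norm x powr (2 * \<beta>) + ((g1 x)\<^sup>2 + (g2 x)\<^sup>2) * norm x powr (2 * \<alpha>)" for x
  \<comment> \<open>At the origin the frame vectors degenerate, but both sides are 0 there because
    the weights are.\<close>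
  have J_eq: "(?v x)\<^sup>2 * norm x powr (2 * \<beta>) +
      ((g x \<bullet> e_r x)\<^sup>2 + (g x \<bullet> e_\<theta> x)\<^sup>2) * norm x powr (2 * \<alpha>) = J x" for x
    using frame_components_norm[of x "g x"] by (cases "x = 0") (simp_all add: J_def g_def)
  obtain M0 where M0: "\<And>x. (?v x)\<^sup>2 \<le> M0 * norm x powr (2 * \<mu>)" "M0 \<ge> 0"
    by (rule homogeneous_bound[OF per sm]) (rule that)
  obtain M1 where M1': "\<And>\<nu> x. (homogeneous \<nu> (partial1 \<mu> \<psi> \<psi>') x)\<^sup>2 \<le> M1 * norm x powr (2 * \<nu>)"
    and M1_nonneg: "M1 \<ge> 0"
    by (rule homogeneous_bound[OF perp(1)[where \<mu> = \<mu>] smp(1)[where \<mu> = \<mu>]]) (rule that)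
  have M1: "(g1 x)\<^sup>2 \<le> M1 * norm x powr (2 * (\<mu> - 1))" for x
    unfolding g1_def by (rule M1')
  obtain M2 where M2': "\<And>\<nu> x. (homogeneous \<nu> (partial2 \<mu> \<psi> \<psi>') x)\<^sup>2 \<le> M2 * norm x powr (2 * \<nu>)"
    and M2_nonneg: "M2 \<ge> 0"
    by (rule homogeneous_bound[OF perp(2)[where \<mu> = \<mu>] smp(2)[where \<mu> = \<mu>]]) (rule that)
  have M2: "(g2 x)\<^sup>2 \<le> M2 * norm x powr (2 * (\<mu> - 1))" for x
    unfolding g2_def by (rule M2')
  \<comment> \<open>Inside the unit ball the smaller exponent gives the larger power, so one
    comparison function covers both parts.\<close>
  define \<gamma> where "\<gamma> = min (2 * \<mu> + 2 * \<beta>) (2 * (\<mu> - 1) + 2 * \<alpha>)"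
  have \<gamma>: "\<gamma> > -2" using w by (auto simp: \<gamma>_def)
  define M where "M = M0 + (M1 + M2)"
  have Jb: "norm (J x) \<le> M * norm x powr \<gamma>" if "norm x < 1" for x
  proof -
    have le: "norm x powr (2 * \<mu> + 2 * \<beta>) \<le> norm x powr \<gamma>" "norm x powr (2 * (\<mu> - 1) + 2 * \<alpha>) \<le> norm x powr \<gamma>"
      using that by (auto intro!: powr_mono' simp: \<gamma>_def)
    have "(?v x)\<^sup>2 * norm x powr (2 * \<beta>) \<le> M0 * norm x powr (2 * \<mu>) * norm x powr (2 * \<beta>)"
      by (intro mult_right_mono M0) simp
    also have "\<dots> = M0 * norm x powr (2 * \<mu> + 2 * \<beta>)" by (simp add: powr_add)
    also have "\<dots> \<le> M0 * norm x powr \<gamma>" by (intro mult_left_mono M0 le)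
    finally have 1: "(?v x)\<^sup>2 * norm x powr (2 * \<beta>) \<le> M0 * norm x powr \<gamma>" .
    have "((g1 x)\<^sup>2 + (g2 x)\<^sup>2) * norm x powr (2 * \<alpha>)
      \<le> (M1 * norm x powr (2 * (\<mu> - 1)) + M2 * norm x powr (2 * (\<mu> - 1))) * norm x powr (2 * \<alpha>)"
      by (intro mult_right_mono add_mono M1 M2) simp
    also have "\<dots> = (M1 + M2) * norm x powr (2 * (\<mu> - 1) + 2 * \<alpha>)" by (simp only: powr_add) algebra
    also have "\<dots> \<le> (M1 + M2) * norm x powr \<gamma>" using M1_nonneg M2_nonneg by (intro mult_left_mono le) simp
    finally have "J x \<le> M * norm x powr \<gamma>" using 1 by (simp add: J_def M_def distrib_right)
    moreover have "0 \<le> J x" by (simp add: J_def)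
    ultimately show ?thesis by simp
  qed
  have int: "integrable lborel (\<lambda>x. indicator (ball 0 1) x *\<^sub>R J x)"
  proof (rule Bochner_Integration.integrable_bound)
    show "integrable lborel (\<lambda>x::real^2. M * (indicator (ball 0 1) x *\<^sub>R norm x powr \<gamma>))"
      using set_integrable_norm_powr[OF \<gamma>] unfolding set_integrable_def
      by (rule integrable_mult_right)
    have "continuous_on (ball 0 1 - {0}) J"
      unfolding J_def
      by (intro continuous_on_add continuous_on_mult continuous_on_power continuous_on_powr continuous_on_norm
        continuous_on_id continuous_on_const continuous_on_subset[OF cv] continuous_on_subset[OF cg(1)]
        continuous_on_subset[OF cg(2)]) auto
    then have "(\<lambda>x. indicator (ball 0 1 - {0}) x *\<^sub>R J x) \<in> borel_measurable borel"
      by (intro borel_measurable_continuous_on_indicator) auto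
    moreover have "(\<lambda>x. indicator (ball 0 1 - {0}) x *\<^sub>R J x) = (\<lambda>x. indicator (ball 0 1) x *\<^sub>R J x)"
      by (auto simp: fun_eq_iff indicator_def J_def)
    ultimately show "(\<lambda>x. indicator (ball 0 1) x *\<^sub>R J x) \<in> borel_measurable lborel"
      unfolding measurable_lborel1 by simp
    show "AE x in lborel. norm (indicator (ball 0 1) x *\<^sub>R J x)
        \<le> norm (M * (indicator (ball 0 1) x *\<^sub>R norm x powr \<gamma>))"
    proof (rule AE_I2)
      fix x :: "real^2"
      show "norm (indicator (ball 0 1) x *\<^sub>R J x) \<le> norm (M * (indicator (ball 0 1) x *\<^sub>R norm x powr \<gamma>))"
      proof (cases "norm x < 1")
        case True
        then show ?thesis using order.trans[OF Jb[OF True] abs_ge_self] by simp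
      qed simp
    qed
  qed
  have "set_integrable lebesgue (ball 0 1) J"
    unfolding set_integrable_def
    by (rule integrable_completion[THEN iffD2, OF borel_measurable_integrable[OF int] int])
  then have "set_integrable lebesgue (ball 0 1) (\<lambda>x. (?v x)\<^sup>2 * norm x powr (2 * \<beta>) +
      ((g x \<bullet> e_r x)\<^sup>2 + (g x \<bullet> e_\<theta> x)\<^sup>2) * norm x powr (2 * \<alpha>))"
    unfolding J_eq .
  moreover have "?v (polar r (t + 2 * pi / real N)) = ?v (polar r t)" if "0 < r" for r t
    using that by (simp add: homogeneous_polar[of \<psi>, OF per] perN)
  ultimately show ?thesis
    using W weak unfolding Y1_def by (intro CollectI conjI allI impI exI[of _ g]) auto
qed

subsection \<open>The angular profile in hodograph coordinates\<close>

text \<open>Multiplying the quadratic polynomial by p - 2 removes b and leaves twice the difference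
  of the two sides. For N = 1 the relation would force k = 1.\<close>

lemma exponent_relation:
  assumes "p > 2" "N \<ge> 1" "k > 1" and e: "exponent_poly p N k = 0"
  shows "N \<ge> 2"
    and "(real N - 1)\<^sup>2 * ((p - 1) * k\<^sup>2 - (p - 2) * k) = (p - 1) * (real N)\<^sup>2 * (k - 1)\<^sup>2"
proof -
  define b where "b = p / (p - 2)"
  have b: "(p - 2) * b = p" using assms by (simp add: b_def)
  have "(2 * real N - 1) * (b + 1) * k\<^sup>2 - 2 * ((real N)\<^sup>2 * b + 2 * real N - 1) * k
      + (real N)\<^sup>2 * (1 + b) = 0"
    using e by (simp add: exponent_poly_def Let_def b_def)
  then have "0 = (p - 2) * ((2 * real N - 1) * (b + 1) * k\<^sup>2 - 2 * ((real N)\<^sup>2 * b + 2 * real N - 1) * k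
      + (real N)\<^sup>2 * (1 + b))" by simp
  also have "\<dots> = (2 * real N - 1) * ((p - 2) * b + (p - 2)) * k\<^sup>2
      - 2 * ((real N)\<^sup>2 * ((p - 2) * b) + (2 * real N - 1) * (p - 2)) * k
      + (real N)\<^sup>2 * ((p - 2) + (p - 2) * b)"
    by algebra
  also have "\<dots> = 2 * ((p - 1) * (real N)\<^sup>2 * (k - 1)\<^sup>2 - (real N - 1)\<^sup>2 * ((p - 1) * k\<^sup>2 - (p - 2) * k))"
    unfolding b by algebra
  finally show r: "(real N - 1)\<^sup>2 * ((p - 1) * k\<^sup>2 - (p - 2) * k) = (p - 1) * (real N)\<^sup>2 * (k - 1)\<^sup>2"
    by simp
  show "N \<ge> 2"
  proof (rule ccontr)
    assume "\<not> N \<ge> 2"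
    then have "N = 1" using assms by simp
    then show False using r assms by simp
  qed
qed

text \<open>The potential is homogeneous of degree 0 and may be discontinuous at the origin, but it
  is bounded. Hence e = a^2 + b^2 satisfies |e'| \<le> const e, and a common zero of
  \<open>a\<close> and \<open>b\<close> would make \<open>a\<close> vanish identically.\<close>

lemma profile_nonvanishing:
  assumes p2: "p > 2" and k1: "k \<ge> 1"
    and da: "\<And>\<theta>. (a has_real_derivative b \<theta>) (at \<theta>)"
    and db: "\<And>\<theta>. (b has_real_derivative - potential p k (a \<theta>) (b \<theta>) * a \<theta>) (at \<theta>)"
    and nz: "a \<theta>\<^sub>0 \<noteq> 0"
  shows "a \<theta> \<noteq> 0 \<or> b \<theta> \<noteq> 0"
proof (rule ccontr)
  assume "\<not> ?thesis"
  then have z: "(a \<theta>)\<^sup>2 + (b \<theta>)\<^sup>2 = 0" by simp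
  define N1 where "N1 = (2 * p - 3) * k\<^sup>2 - (p - 2) * k"
  define N2 where "N2 = (p - 1) * k\<^sup>2 - (p - 2) * k"
  have "k * 1 \<le> k * k" using p2 k1 by (intro mult_left_mono) auto
  then have "(p - 2) * k \<le> (p - 2) * k\<^sup>2"
    using p2 k1 by (intro mult_left_mono) (auto simp: power2_eq_square)
  moreover have "0 \<le> (p - 1) * k\<^sup>2" "0 \<le> k\<^sup>2" using p2 k1 by auto
  moreover have "N1 = ((p - 2) * k\<^sup>2 - (p - 2) * k) + (p - 1) * k\<^sup>2"
      "N2 = ((p - 2) * k\<^sup>2 - (p - 2) * k) + k\<^sup>2"
    unfolding N1_def N2_def by algebra+
  ultimately have N: "0 \<le> N1" "0 \<le> N2" by linarith+
  have V: "0 \<le> potential p k y z \<and> potential p k y z \<le> N1 + N2" for y z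
  proof -
    have d: "0 \<le> (p - 1) * z\<^sup>2 + k\<^sup>2 * y\<^sup>2" using p2 k1 by auto
    have "N1 * z\<^sup>2 + N2 * (k\<^sup>2 * y\<^sup>2) \<le> (N1 + N2) * z\<^sup>2 + (N1 + N2) * (k\<^sup>2 * y\<^sup>2)"
      using N by (intro add_mono mult_right_mono) auto
    also have "\<dots> \<le> (N1 + N2) * ((p - 1) * z\<^sup>2) + (N1 + N2) * (k\<^sup>2 * y\<^sup>2)"
      using N p2 mult_right_mono[of 1 "p - 1" "z\<^sup>2"] by (intro add_mono mult_left_mono order.refl) simp_all
    finally have "N1 * z\<^sup>2 + N2 * (k\<^sup>2 * y\<^sup>2) \<le> (N1 + N2) * ((p - 1) * z\<^sup>2 + k\<^sup>2 * y\<^sup>2)"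
      by (simp add: algebra_simps)
    then have "(N1 * z\<^sup>2 + N2 * (k\<^sup>2 * y\<^sup>2)) / ((p - 1) * z\<^sup>2 + k\<^sup>2 * y\<^sup>2) \<le> N1 + N2"
      using d N by (cases "(p - 1) * z\<^sup>2 + k\<^sup>2 * y\<^sup>2 = 0") (auto simp: divide_le_eq less_le)
    moreover have "0 \<le> (N1 * z\<^sup>2 + N2 * (k\<^sup>2 * y\<^sup>2)) / ((p - 1) * z\<^sup>2 + k\<^sup>2 * y\<^sup>2)"
      using d N p2 by (intro divide_nonneg_nonneg add_nonneg_nonneg mult_nonneg_nonneg) auto
    moreover have "potential p k y z = (N1 * z\<^sup>2 + N2 * (k\<^sup>2 * y\<^sup>2)) / ((p - 1) * z\<^sup>2 + k\<^sup>2 * y\<^sup>2)"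
      by (simp add: potential_def N1_def N2_def mult.assoc)
    ultimately show ?thesis by simp
  qed
  define e where "e t = (a t)\<^sup>2 + (b t)\<^sup>2" for t
  have de: "(e has_real_derivative 2 * (a t * b t) * (1 - potential p k (a t) (b t))) (at t)" for t
    unfolding e_def by (auto intro!: derivative_eq_intros da db simp: algebra_simps)
  have be: "\<bar>2 * (a t * b t) * (1 - potential p k (a t) (b t))\<bar> \<le> (1 + (N1 + N2)) * e t" for t
  proof -
    have "\<bar>1 - potential p k (a t) (b t)\<bar> \<le> 1 + (N1 + N2)" using V[of "a t" "b t"] by auto
    moreover have "\<bar>2 * (a t * b t)\<bar> \<le> e t"
      using sum_squares_bound[of "a t" "b t"] sum_squares_bound[of "a t" "- b t"]
      by (simp add: e_def abs_le_iff)
    ultimately have "\<bar>2 * (a t * b t)\<bar> * \<bar>1 - potential p k (a t) (b t)\<bar> \<le> e t * (1 + (N1 + N2))"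
      by (intro mult_mono) (auto simp: e_def)
    then show ?thesis by (simp add: abs_mult mult.commute)
  qed
  have "e \<theta>\<^sub>0 = 0"
    using linear_growth_nonzero[OF de be, of \<theta> \<theta>\<^sub>0] z by (auto simp: e_def)
  then show False using nz by (simp add: e_def)
qed

section \<open>Phase, amplitude and first integral of the profile\<close>

locale angular_profile =
  fixes p k :: real and N :: nat and a b :: "real \<Rightarrow> real"
  assumes p2: "p > 2" and k1: "k > 1" and N2: "N \<ge> 2"
    and exponent: "(real N - 1)\<^sup>2 * ((p - 1) * k\<^sup>2 - (p - 2) * k) = (p - 1) * (real N)\<^sup>2 * (k - 1)\<^sup>2"
    and da: "\<And>\<theta>. (a has_real_derivative b \<theta>) (at \<theta>)"
    and ode: "\<And>\<theta>. (b has_real_derivative - potential p k (a \<theta>) (b \<theta>) * a \<theta>) (at \<theta>)"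
    and nonvanishing: "\<And>\<theta>. a \<theta> \<noteq> 0 \<or> b \<theta> \<noteq> 0"
    and periodic: "\<And>\<theta>. a (\<theta> + 2 * pi / real N) = a \<theta>"
    and smooth: "\<And>n. Cn_on n UNIV a"
begin

text \<open>\<open>E\<close> is the denominator of the potential. In the hodograph plane \<open>f\<close> itself is a multiple of
  \<open>q powr (k / (k - 1)) * cos (m * \<eta>)\<close> up to a rotation, and \<open>\<kappa> = m * (k - 1) / k\<close>; the phase \<open>\<tau>\<close> below
  is the argument of \<open>(\<kappa> k a, - b)\<close>, which has length \<open>sqrt P\<close>.\<close>

definition \<rho> where "\<rho> \<theta> = k\<^sup>2 * (a \<theta>)\<^sup>2 + (b \<theta>)\<^sup>2"
definition E where "E \<theta> = (p - 1) * (b \<theta>)\<^sup>2 + k\<^sup>2 * (a \<theta>)\<^sup>2"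
definition \<kappa> where "\<kappa> = sqrt (((p - 1) * k - (p - 2)) / ((p - 1) * k))"
definition m where "m = real N / (real N - 1)"
definition P where "P \<theta> = (\<kappa> * k * a \<theta>)\<^sup>2 + (b \<theta>)\<^sup>2"

lemma kappa: "0 < \<kappa>" "\<kappa> < 1" "\<kappa>\<^sup>2 = ((p - 1) * k - (p - 2)) / ((p - 1) * k)"
proof -
  have "p - 2 < (p - 1) * 1" by simp
  also have "\<dots> < (p - 1) * k" using p2 k1 by (intro mult_strict_left_mono) auto
  finally have "0 < ((p - 1) * k - (p - 2)) / ((p - 1) * k)" "((p - 1) * k - (p - 2)) / ((p - 1) * k) < 1"
    using p2 k1 by (auto simp: divide_less_eq)
  then show "0 < \<kappa>" "\<kappa> < 1" "\<kappa>\<^sup>2 = ((p - 1) * k - (p - 2)) / ((p - 1) * k)"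
    by (auto simp: \<kappa>_def real_sqrt_lt_1_iff)
qed

lemma kappa_sq: "(p - 1) * k * \<kappa>\<^sup>2 = (p - 1) * k - (p - 2)"
  using kappa(3) p2 k1 by simp

lemma m_pos: "m > 1" "m > 0" using N2 by (auto simp: m_def field_simps)

text \<open>The positive square root of the relation \<open>exponent\<close>: through it the
  quadratic equation for k enters the later computations.\<close>

lemma m_kappa: "m * (k - 1) = \<kappa> * k"
proof -
  have "(real N - 1)\<^sup>2 * (\<kappa> * k)\<^sup>2 * (p - 1) = (real N - 1)\<^sup>2 * ((p - 1) * k * \<kappa>\<^sup>2) * k"
    by (simp add: power2_eq_square)
  also have "\<dots> = (real N)\<^sup>2 * (k - 1)\<^sup>2 * (p - 1)"
    unfolding kappa_sq using exponent by (simp add: power2_eq_square algebra_simps)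
  finally have "((real N - 1) * (\<kappa> * k))\<^sup>2 = (real N * (k - 1))\<^sup>2"
    using p2 by (simp add: power_mult_distrib)
  moreover have "0 \<le> (real N - 1) * (\<kappa> * k)" "0 \<le> real N * (k - 1)"
    using kappa k1 N2 by auto
  ultimately have "(real N - 1) * (\<kappa> * k) = real N * (k - 1)"
    using power2_eq_iff_nonneg by blast
  then show ?thesis using N2 by (simp add: m_def field_simps)
qed

lemma pos: "0 < \<rho> \<theta>" "0 < E \<theta>" "0 < P \<theta>"
  using nonvanishing[of \<theta>] p2 k1 kappa(1)
  by (auto simp: \<rho>_def E_def P_def add_pos_nonneg add_nonneg_pos)

text \<open>The potential is k^2 plus a multiple of \<rho> / E. The k^2 part cancels in the
  derivative of \<rho>, which is therefore a multiple of \<rho> itself.\<close>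

lemma db: "(b has_real_derivative - k\<^sup>2 * a \<theta> - (p - 2) * k * (k - 1) * a \<theta> * \<rho> \<theta> / E \<theta>) (at \<theta>)"
proof -
  have "potential p k (a \<theta>) (b \<theta>) * E \<theta> = ((2 * p - 3) * k\<^sup>2 - (p - 2) * k) * (b \<theta>)\<^sup>2
      + ((p - 1) * k\<^sup>2 - (p - 2) * k) * k\<^sup>2 * (a \<theta>)\<^sup>2"
    using pos(2)[of \<theta>] unfolding potential_def E_def[symmetric] by simp
  also have "\<dots> = k\<^sup>2 * E \<theta> + (p - 2) * k * (k - 1) * \<rho> \<theta>"
    unfolding E_def \<rho>_def by algebra
  finally have "potential p k (a \<theta>) (b \<theta>) * E \<theta> = k\<^sup>2 * E \<theta> + (p - 2) * k * (k - 1) * \<rho> \<theta>" .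
  then have "potential p k (a \<theta>) (b \<theta>) = k\<^sup>2 + (p - 2) * k * (k - 1) * \<rho> \<theta> / E \<theta>"
    using pos(2)[of \<theta>] by (simp add: field_simps)
  then show ?thesis using ode[of \<theta>] by (simp add: algebra_simps)
qed

lemma d\<rho>: "(\<rho> has_real_derivative - 2 * (p - 2) * k * (k - 1) * a \<theta> * b \<theta> * \<rho> \<theta> / E \<theta>) (at \<theta>)"
proof -
  have eq: "(\<lambda>\<theta>. k\<^sup>2 * (a \<theta> * a \<theta>) + b \<theta> * b \<theta>) = \<rho>" by (simp add: \<rho>_def[abs_def] power2_eq_square)
  have "((\<lambda>\<theta>. k\<^sup>2 * (a \<theta> * a \<theta>) + b \<theta> * b \<theta>) has_real_derivative
      - 2 * (p - 2) * k * (k - 1) * a \<theta> * b \<theta> * \<rho> \<theta> / E \<theta>) (at \<theta>)"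
    by (rule derivative_eq_intros da db refl)+ (unfold divide_inverse, algebra)
  then show ?thesis unfolding eq .
qed

lemma isCont_ab: "isCont a \<theta>" "isCont b \<theta>"
  using da db DERIV_isCont by blast+

lemma isCont_aux: "isCont \<rho> \<theta>" "isCont E \<theta>" "isCont P \<theta>"
  unfolding \<rho>_def[abs_def] E_def[abs_def] P_def[abs_def]
  by (intro continuous_intros isCont_ab)+

text \<open>Combined with \<open>D_tau\<close>, this expresses E / \<rho> by the phase alone, as
  \<open>dtheta_dtau\<close> requires.\<close>

lemma P_E: "m * P \<theta> - \<kappa> * \<rho> \<theta> = \<kappa> / ((k - 1) * (p - 1)) * E \<theta>"
proof -
  have "(k - 1) * (p - 1) * (m * P \<theta> - \<kappa> * \<rho> \<theta>)
     = (p - 1) * (m * (k - 1)) * P \<theta> - \<kappa> * (k - 1) * (p - 1) * \<rho> \<theta>" by algebra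
  also have "\<dots> = \<kappa> * (k\<^sup>2 * (a \<theta>)\<^sup>2 * ((p - 1) * k * \<kappa>\<^sup>2 - (p - 1) * (k - 1)) + (p - 1) * (b \<theta>)\<^sup>2)"
    unfolding m_kappa \<rho>_def P_def by algebra
  also have "\<dots> = \<kappa> * E \<theta>" unfolding kappa_sq E_def by algebra
  finally have "(m * P \<theta> - \<kappa> * \<rho> \<theta>) * ((k - 1) * (p - 1)) = \<kappa> * E \<theta>"
    by (simp only: mult.commute)
  moreover have "(k - 1) * (p - 1) \<noteq> 0" using p2 k1 by simp
  ultimately show ?thesis
    by (simp only: times_divide_eq_left nonzero_eq_divide_eq[of "(k - 1) * (p - 1)"] not_False_eq_True)
qed

text \<open>Equal to - m times the \<theta>-derivative of \<eta>, the direction of the gradient of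
  f; it is the speed of the phase \<tau>.\<close>

definition \<omega> where "\<omega> \<theta> = m * (p - 1) * (k - 1) * \<rho> \<theta> / E \<theta>"

lemma omega_pos: "\<omega> \<theta> > 0"
  using pos m_pos p2 k1 by (simp add: \<omega>_def)

lemma isCont_omega: "isCont \<omega> \<theta>"
  unfolding \<omega>_def[abs_def] using pos(2) by (intro continuous_intros isCont_aux) (auto simp: less_imp_neq[THEN not_sym])

text \<open>For the curve (x, y) = (\<kappa> k a, - b) the rates in \<open>polar_lift\<close> must
  be (x x' + y y') / P and (x y' - y x') / P, where y' is the function \<open>c\<close>. The
  relations \<open>m_kappa\<close> and \<open>kappa_sq\<close> bring the second rate to the closed
  form \<omega>.\<close>

lemma lift_exists:
  obtains \<tau> where "\<And>\<theta>. (\<tau> has_real_derivative \<omega> \<theta>) (at \<theta>)"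
    and "\<And>\<theta>. \<kappa> * k * a \<theta> = sqrt (P \<theta>) * cos (\<tau> \<theta>)"
    and "\<And>\<theta>. - b \<theta> = sqrt (P \<theta>) * sin (\<tau> \<theta>)"
proof -
  define c where "c \<theta> = k\<^sup>2 * a \<theta> + (p - 2) * k * (k - 1) * a \<theta> * \<rho> \<theta> / E \<theta>" for \<theta>
  define u where "u \<theta> = (\<kappa>\<^sup>2 * k\<^sup>2 * a \<theta> - c \<theta>) * b \<theta> / P \<theta>" for \<theta>
  have cE: "c \<theta> * E \<theta> = k\<^sup>2 * a \<theta> * E \<theta> + (p - 2) * k * (k - 1) * a \<theta> * \<rho> \<theta>" for \<theta>
    using pos[of \<theta>] by (simp add: c_def field_simps)
  have w: "\<omega> \<theta> * P \<theta> = \<kappa> * k * (a \<theta> * c \<theta> + (b \<theta>)\<^sup>2)" for \<theta>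
  proof -
    have "\<omega> \<theta> * P \<theta> * E \<theta> = (p - 1) * (m * (k - 1)) * \<rho> \<theta> * P \<theta>"
      using pos[of \<theta>] by (simp add: \<omega>_def field_simps)
    also have "\<dots> = \<kappa> * k * \<rho> \<theta> * (((p - 1) * k * \<kappa>\<^sup>2) * k * (a \<theta>)\<^sup>2 + (p - 1) * (b \<theta>)\<^sup>2)"
      unfolding m_kappa P_def by algebra
    also have "\<dots> = \<kappa> * k * (a \<theta> * (c \<theta> * E \<theta>) + (b \<theta>)\<^sup>2 * E \<theta>)"
      unfolding cE kappa_sq unfolding E_def \<rho>_def by algebra
    also have "\<dots> = \<kappa> * k * (a \<theta> * c \<theta> + (b \<theta>)\<^sup>2) * E \<theta>" by algebra
    finally show ?thesis using pos(2)[of \<theta>] by simp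
  qed
  show ?thesis
  proof (rule polar_lift[where x = "\<lambda>\<theta>. \<kappa> * k * a \<theta>" and y = "\<lambda>\<theta>. - b \<theta>" and u = u and w = \<omega>])
    fix \<theta>
    have uP: "u \<theta> * P \<theta> = (\<kappa>\<^sup>2 * k\<^sup>2 * a \<theta> - c \<theta>) * b \<theta>" using pos[of \<theta>] by (simp add: u_def)
    have "(u \<theta> * (\<kappa> * k * a \<theta>) - \<omega> \<theta> * (- b \<theta>)) * P \<theta>
        = (u \<theta> * P \<theta>) * (\<kappa> * k * a \<theta>) + (\<omega> \<theta> * P \<theta>) * b \<theta>" by algebra
    also have "\<dots> = \<kappa> * k * b \<theta> * P \<theta>"
      unfolding uP w unfolding P_def by algebra
    finally have "u \<theta> * (\<kappa> * k * a \<theta>) - \<omega> \<theta> * (- b \<theta>) = \<kappa> * k * b \<theta>"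
      using pos[of \<theta>] by simp
    then show "((\<lambda>\<theta>. \<kappa> * k * a \<theta>) has_real_derivative u \<theta> * (\<kappa> * k * a \<theta>) - \<omega> \<theta> * (- b \<theta>)) (at \<theta>)"
      by (auto intro!: derivative_eq_intros da)
    have "(u \<theta> * (- b \<theta>) + \<omega> \<theta> * (\<kappa> * k * a \<theta>)) * P \<theta>
        = (\<omega> \<theta> * P \<theta>) * (\<kappa> * k * a \<theta>) - (u \<theta> * P \<theta>) * b \<theta>" by algebra
    also have "\<dots> = c \<theta> * P \<theta>"
      unfolding uP w unfolding P_def by algebra
    finally have "u \<theta> * (- b \<theta>) + \<omega> \<theta> * (\<kappa> * k * a \<theta>) = c \<theta>"
      using pos[of \<theta>] by simp
    then show "((\<lambda>\<theta>. - b \<theta>) has_real_derivative u \<theta> * (- b \<theta>) + \<omega> \<theta> * (\<kappa> * k * a \<theta>)) (at \<theta>)"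
      by (auto intro!: derivative_eq_intros db simp: c_def)
    show "isCont u \<theta>" unfolding u_def[abs_def] c_def[abs_def] using pos
      by (intro continuous_intros isCont_aux isCont_ab) (auto simp: less_imp_neq[THEN not_sym])
    show "isCont \<omega> \<theta>" by (rule isCont_omega)
    show "0 < (\<kappa> * k * a \<theta>)\<^sup>2 + (- b \<theta>)\<^sup>2" using pos(3)[of \<theta>] by (simp add: P_def)
  qed (use that in \<open>auto simp: P_def\<close>)
qed

definition \<tau> where "\<tau> = (SOME \<tau>. \<forall>\<theta>. (\<tau> has_real_derivative \<omega> \<theta>) (at \<theta>)
    \<and> \<kappa> * k * a \<theta> = sqrt (P \<theta>) * cos (\<tau> \<theta>) \<and> - b \<theta> = sqrt (P \<theta>) * sin (\<tau> \<theta>))"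

lemma tau: "(\<tau> has_real_derivative \<omega> \<theta>) (at \<theta>)"
  "\<kappa> * k * a \<theta> = sqrt (P \<theta>) * cos (\<tau> \<theta>)" "- b \<theta> = sqrt (P \<theta>) * sin (\<tau> \<theta>)"
proof -
  obtain \<tau>' where "\<And>\<theta>. (\<tau>' has_real_derivative \<omega> \<theta>) (at \<theta>)"
    "\<And>\<theta>. \<kappa> * k * a \<theta> = sqrt (P \<theta>) * cos (\<tau>' \<theta>)" "\<And>\<theta>. - b \<theta> = sqrt (P \<theta>) * sin (\<tau>' \<theta>)"
    by (rule lift_exists) blast
  then have "\<exists>\<tau>. \<forall>\<theta>. (\<tau> has_real_derivative \<omega> \<theta>) (at \<theta>)
      \<and> \<kappa> * k * a \<theta> = sqrt (P \<theta>) * cos (\<tau> \<theta>) \<and> - b \<theta> = sqrt (P \<theta>) * sin (\<tau> \<theta>)"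
    by (intro exI[of _ \<tau>'] allI conjI)
  from someI_ex[OF this, folded \<tau>_def]
  show "(\<tau> has_real_derivative \<omega> \<theta>) (at \<theta>)"
    "\<kappa> * k * a \<theta> = sqrt (P \<theta>) * cos (\<tau> \<theta>)" "- b \<theta> = sqrt (P \<theta>) * sin (\<tau> \<theta>)" by blast+
qed

definition D where "D t = (cos t)\<^sup>2 + \<kappa>\<^sup>2 * (sin t)\<^sup>2"

lemma D_pos: "0 < D t"
  using kappa(1) sin_cos_squared_add[of t] by (cases "cos t = 0") (auto simp: D_def add_pos_nonneg)

lemma D_tau: "D (\<tau> \<theta>) * P \<theta> = \<kappa>\<^sup>2 * \<rho> \<theta>"
proof -
  have "D (\<tau> \<theta>) * P \<theta> = (sqrt (P \<theta>) * cos (\<tau> \<theta>))\<^sup>2 + \<kappa>\<^sup>2 * (sqrt (P \<theta>) * sin (\<tau> \<theta>))\<^sup>2"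
    using pos(3)[of \<theta>] by (simp add: D_def power_mult_distrib algebra_simps)
  also have "\<dots> = \<kappa>\<^sup>2 * \<rho> \<theta>"
    unfolding tau(2,3)[symmetric] \<rho>_def by algebra
  finally show ?thesis .
qed

text \<open>Since \<omega> is the derivative of \<tau>, this gives d\<theta>/d\<tau> as a function
  of \<tau> alone: the weight in the substitution behind the mean of \<phi>.\<close>

lemma dtheta_dtau: "\<omega> \<theta> * (m * \<kappa> / D (\<tau> \<theta>) - 1) = m"
proof -
  have P: "P \<theta> = \<kappa>\<^sup>2 * \<rho> \<theta> / D (\<tau> \<theta>)" using D_tau[of \<theta>] D_pos[of "\<tau> \<theta>"] by (simp add: field_simps)
  have "\<kappa> * (\<rho> \<theta> * (m * \<kappa> / D (\<tau> \<theta>) - 1)) = m * P \<theta> - \<kappa> * \<rho> \<theta>"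
    unfolding P divide_inverse by algebra
  also have "\<dots> = \<kappa> * (E \<theta> / ((k - 1) * (p - 1)))"
    unfolding P_E by (simp only: times_divide_eq_left times_divide_eq_right)
  finally have "\<rho> \<theta> * (m * \<kappa> / D (\<tau> \<theta>) - 1) = E \<theta> / ((k - 1) * (p - 1))"
    using kappa(1) by (metis mult_left_cancel less_irrefl)
  then have e: "\<rho> \<theta> * (m * \<kappa> / D (\<tau> \<theta>) - 1) * ((k - 1) * (p - 1)) = E \<theta>"
    using p2 k1 by simp
  have h: "m * (p - 1) * (k - 1) * \<rho> \<theta> * (m * \<kappa> / D (\<tau> \<theta>) - 1) = m * E \<theta>"
    unfolding e[symmetric] by algebra
  have "\<omega> \<theta> * (m * \<kappa> / D (\<tau> \<theta>) - 1) = m * E \<theta> / E \<theta>"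
    unfolding \<omega>_def times_divide_eq_left h ..
  then show ?thesis using pos(2)[of \<theta>] by simp
qed

text \<open>The logarithmic derivatives of \<rho> and D(\<tau>) are both multiples of a b / E, the
  first being - (k - 1) times the second. So \<rho> D(\<tau>)^(k-1) is a first integral, and the
  amplitude is a function of the phase.\<close>

lemma rho_D: "ln (\<rho> \<theta>) + (k - 1) * ln (D (\<tau> \<theta>)) = ln (\<rho> 0) + (k - 1) * ln (D (\<tau> 0))"
proof -
  have "((\<lambda>\<theta>. ln (\<rho> \<theta>) + (k - 1) * ln (D (\<tau> \<theta>))) has_real_derivative 0) (at \<theta>)" for \<theta>
  proof -
    define w where "w = \<omega> \<theta>"
    define s where "s = sin (\<tau> \<theta>)"
    define c where "c = cos (\<tau> \<theta>)"
    define Q where "Q = P \<theta>"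
    define d where "d = D (\<tau> \<theta>)"
    have "(D has_real_derivative 2 * (\<kappa>\<^sup>2 - 1) * sin t * cos t) (at t)" for t
      unfolding D_def[abs_def] by (rule derivative_eq_intros refl)+ (simp add: algebra_simps)
    from DERIV_chain2[OF this tau(1)]
    have dD: "((\<lambda>\<theta>. D (\<tau> \<theta>)) has_real_derivative 2 * (\<kappa>\<^sup>2 - 1) * s * c * w) (at \<theta>)"
      by (simp add: s_def c_def w_def)
    have "Q * (s * c) = - (\<kappa> * k * a \<theta> * b \<theta>)"
    proof -
      have "Q * (s * c) = (sqrt Q * c) * (sqrt Q * s)" using pos[of \<theta>] by (simp add: Q_def)
      then show ?thesis unfolding Q_def c_def s_def tau(2,3)[symmetric] by simp
    qed
    moreover have "d * Q = \<kappa>\<^sup>2 * \<rho> \<theta>" using D_tau by (simp add: d_def Q_def)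
    moreover have wE: "w * E \<theta> = m * (p - 1) * (k - 1) * \<rho> \<theta>"
      using pos[of \<theta>] by (simp add: w_def \<omega>_def)
    \<comment> \<open>The factor Q makes \<open>s * c\<close> and \<open>d\<close> expressible by a,
      b and \<rho>; together with \<kappa> it is cancelled afterwards.\<close>
    ultimately have "\<kappa> * Q * ((k - 1) * (2 * (\<kappa>\<^sup>2 - 1) * s * c * w) * E \<theta>)
        = \<kappa> * Q * ((2 * (p - 2) * k * (k - 1) * a \<theta> * b \<theta>) * d)"
    proof -
      have "\<kappa> * Q * ((k - 1) * (2 * (\<kappa>\<^sup>2 - 1) * s * c * w) * E \<theta>)
         = 2 * \<kappa> * (k - 1) * (\<kappa>\<^sup>2 - 1) * (Q * (s * c)) * (w * E \<theta>)" by algebra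
      also have "\<dots> = 2 * \<kappa>\<^sup>2 * (k - 1) * ((p - 1) * k - (p - 1) * k * \<kappa>\<^sup>2) * (m * (k - 1)) * a \<theta> * b \<theta> * \<rho> \<theta>"
        unfolding \<open>Q * (s * c) = _\<close> wE by algebra
      also have "\<dots> = 2 * (p - 2) * k * (k - 1) * \<kappa> * a \<theta> * b \<theta> * (\<kappa>\<^sup>2 * \<rho> \<theta>)"
        unfolding kappa_sq m_kappa by algebra
      finally show ?thesis unfolding \<open>d * Q = _\<close>[symmetric] by algebra
    qed
    then have "(k - 1) * (2 * (\<kappa>\<^sup>2 - 1) * s * c * w) * E \<theta> = 2 * (p - 2) * k * (k - 1) * a \<theta> * b \<theta> * d"
      using kappa(1) pos(3)[of \<theta>] by (simp add: Q_def)
    then have e: "(k - 1) * (2 * (\<kappa>\<^sup>2 - 1) * s * c * w / d) = - (- 2 * (p - 2) * k * (k - 1) * a \<theta> * b \<theta>) / E \<theta>"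
      using pos(2)[of \<theta>] D_pos[of "\<tau> \<theta>"] by (simp add: d_def field_simps)
    have "((\<lambda>\<theta>. ln (\<rho> \<theta>) + (k - 1) * ln (D (\<tau> \<theta>))) has_real_derivative
        (- 2 * (p - 2) * k * (k - 1) * a \<theta> * b \<theta> * \<rho> \<theta> / E \<theta>) / \<rho> \<theta>
         + (k - 1) * (2 * (\<kappa>\<^sup>2 - 1) * s * c * w / d)) (at \<theta>)"
      using pos(1)[of \<theta>] D_pos[of "\<tau> \<theta>"]
      by (auto intro!: derivative_eq_intros d\<rho> dD simp: d_def)
    moreover have "t * \<rho> \<theta> / E \<theta> / \<rho> \<theta> + (- t) / E \<theta> = 0" for t
      using pos(1)[of \<theta>] by simp
    ultimately show ?thesis unfolding e by simp
  qed
  from deriv_zero_imp_const[OF this] show ?thesis .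
qed

lemma rho_powr:
  obtains c where "c > 0" "\<And>\<theta>. \<rho> \<theta> = c * D (\<tau> \<theta>) powr (- (k - 1))"
proof
  show "\<rho> \<theta> = exp (ln (\<rho> 0) + (k - 1) * ln (D (\<tau> 0))) * D (\<tau> \<theta>) powr (- (k - 1))" for \<theta>
    unfolding rho_D[of \<theta>, symmetric] using D_pos[of "\<tau> \<theta>"] pos(1)[of \<theta>]
    by (simp add: powr_def algebra_simps flip: exp_add)
qed simp

lemma smooth_b: "Cn_on n UNIV b"
  using Cn_on_real_deriv[OF smooth da] .

lemma smooth_rho: "Cn_on n UNIV \<rho>"
  unfolding \<rho>_def[abs_def] power2_eq_square
  by (intro Cn_on_add Cn_on_mult Cn_on_const smooth smooth_b)

lemma smooth_tau: "Cn_on n UNIV \<tau>"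
proof (cases n)
  case 0
  then show ?thesis using tau(1) DERIV_isCont continuous_at_imp_continuous_on by (metis Cn_on.simps(1))
next
  case (Suc l)
  have "Cn_on l UNIV (\<lambda>\<theta>. m * (p - 1) * (k - 1) * \<rho> \<theta> * inverse (E \<theta>))"
    using pos(2) unfolding E_def[abs_def] power2_eq_square
    by (intro Cn_on_mult Cn_on_const smooth_rho Cn_on_inverse Cn_on_add smooth smooth_b)
  then have "Cn_on l UNIV \<omega>" by (simp add: \<omega>_def[abs_def] divide_inverse)
  then show ?thesis unfolding Suc by (rule Cn_on_Suc_realI[OF tau(1)])
qed

section \<open>The separated solution and its flux\<close>

definition \<nu> where "\<nu> = (- (p - 2) + sqrt ((p - 2)\<^sup>2 + 16 * (real N)\<^sup>2 * (p - 1))) / 2"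

lemma nu: "\<nu> > 0" "\<nu> * (\<nu> + (p - 2)) = 4 * (real N)\<^sup>2 * (p - 1)"
proof -
  have d: "(p - 2)\<^sup>2 < (p - 2)\<^sup>2 + 16 * (real N)\<^sup>2 * (p - 1)" using p2 N2 by simp
  then have "p - 2 < sqrt ((p - 2)\<^sup>2 + 16 * (real N)\<^sup>2 * (p - 1))"
    using real_less_rsqrt by blast
  then show "\<nu> > 0" by (simp add: \<nu>_def)
  have "\<nu> * (\<nu> + (p - 2)) = ((sqrt ((p - 2)\<^sup>2 + 16 * (real N)\<^sup>2 * (p - 1)))\<^sup>2 - (p - 2)\<^sup>2) / 4"
    unfolding \<nu>_def by (simp add: field_simps power2_eq_square)
  also have "\<dots> = 4 * (real N)\<^sup>2 * (p - 1)"
    using d by (subst real_sqrt_pow2) (auto intro: order.trans[OF zero_le_power2 less_imp_le])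
  finally show "\<nu> * (\<nu> + (p - 2)) = 4 * (real N)\<^sup>2 * (p - 1)" .
qed

text \<open>With M = 2 N as in the overview, \<nu> is the positive root of the equation for the
  exponent of q, and l = M / m turns M \<eta> into l \<tau>, up to sign and an additive constant.
  Then r powr \<mu> * \<phi> is q powr \<nu> * cos (l \<tau>), because q^2 = r^(2 (k - 1))
  \<rho>.\<close>

definition l where "l = 2 * (real N - 1)"
definition \<mu> where "\<mu> = (k - 1) * \<nu>"
definition \<phi> where "\<phi> \<theta> = \<rho> \<theta> powr (\<nu> / 2) * cos (l * \<tau> \<theta>)"
definition \<phi>' where "\<phi>' \<theta> = - ((p - 2) * k * (k - 1) * \<nu> * a \<theta> * b \<theta> / E \<theta>) * \<phi> \<theta>
   - l * \<omega> \<theta> * \<rho> \<theta> powr (\<nu> / 2) * sin (l * \<tau> \<theta>)"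

lemma smooth_phi: "Cn_on n UNIV \<phi>"
  unfolding \<phi>_def[abs_def]
  using Cn_on_sin_cos[OF Cn_on_mult[OF Cn_on_const[of n l] smooth_tau]] pos(1)
  by (intro Cn_on_mult Cn_on_powr smooth_rho) auto

lemma dpowr: "((\<lambda>\<theta>. \<rho> \<theta> powr s) has_real_derivative
    - (2 * s * (p - 2) * k * (k - 1) * a \<theta> * b \<theta> / E \<theta>) * \<rho> \<theta> powr s) (at \<theta>)"
proof -
  have "((\<lambda>\<theta>. \<rho> \<theta> powr s) has_real_derivative
     s * \<rho> \<theta> powr (s - 1) * (- 2 * (p - 2) * k * (k - 1) * a \<theta> * b \<theta> * \<rho> \<theta> / E \<theta>)) (at \<theta>)"
    using DERIV_chain2[OF has_real_derivative_powr[OF pos(1)] d\<rho>] .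
  moreover have e: "\<rho> \<theta> powr (s - 1) * \<rho> \<theta> = \<rho> \<theta> powr s"
    using pos(1)[of \<theta>] powr_add[of "\<rho> \<theta>" "s - 1" 1] by simp
  have "s * \<rho> \<theta> powr (s - 1) * (- 2 * (p - 2) * k * (k - 1) * a \<theta> * b \<theta> * \<rho> \<theta> / E \<theta>)
    = - (2 * s * (p - 2) * k * (k - 1) * a \<theta> * b \<theta> / E \<theta>) * \<rho> \<theta> powr s"
    unfolding e[symmetric] divide_inverse by algebra
  ultimately show ?thesis by simp
qed

lemma dphi: "(\<phi> has_real_derivative \<phi>' \<theta>) (at \<theta>)"
  unfolding \<phi>_def[abs_def]
  by (rule derivative_eq_intros dpowr tau(1) refl)+
    (unfold \<phi>'_def \<phi>_def divide_inverse, simp add: algebra_simps)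

lemma l_omega: "l * \<omega> \<theta> = 2 * real N * (p - 1) * (k - 1) * \<rho> \<theta> / E \<theta>"
proof -
  have "l * m = 2 * real N" using N2 by (simp add: l_def m_def field_simps)
  then show ?thesis by (simp add: \<omega>_def mult.assoc[symmetric])
qed

text \<open>\<open>flux1\<close> and \<open>flux2\<close> are the frame components of the matrix
  applied to the gradient of r powr \<mu> * \<phi>, with the common power of r taken out.\<close>

definition flux1 where "flux1 \<theta> = \<rho> \<theta> powr ((p - 4) / 2) *
  (((b \<theta>)\<^sup>2 + (p - 1) * k\<^sup>2 * (a \<theta>)\<^sup>2) * (\<mu> * \<phi> \<theta>) + (p - 2) * k * a \<theta> * b \<theta> * \<phi>' \<theta>)"
definition flux2 where "flux2 \<theta> = \<rho> \<theta> powr ((p - 4) / 2) *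
  ((p - 2) * k * a \<theta> * b \<theta> * (\<mu> * \<phi> \<theta>) + (k\<^sup>2 * (a \<theta>)\<^sup>2 + (p - 1) * (b \<theta>)\<^sup>2) * \<phi>' \<theta>)"

definition K where "K \<theta> = \<rho> \<theta> powr ((p - 2 + \<nu>) / 2)"

lemma K_eq: "\<rho> \<theta> powr ((p - 4) / 2) * \<rho> \<theta> powr (\<nu> / 2) * \<rho> \<theta> = K \<theta>"
proof -
  have "\<rho> \<theta> powr ((p - 4) / 2) * \<rho> \<theta> powr (\<nu> / 2) * \<rho> \<theta> powr 1 = \<rho> \<theta> powr ((p - 4) / 2 + \<nu> / 2 + 1)"
    by (simp only: powr_add)
  also have "(p - 4) / 2 + \<nu> / 2 + 1 = (p - 2 + \<nu>) / 2" by (simp add: field_simps)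
  finally show ?thesis using pos(1)[of \<theta>] by (simp add: K_def)
qed

text \<open>The cosine drops out because the coordinates \<open>log q\<close> and \<open>\<eta>\<close> diagonalize the matrix.\<close>

lemma flux2_eq: "flux2 \<theta> = - 2 * real N * (p - 1) * (k - 1) * K \<theta> * sin (l * \<tau> \<theta>)"
proof -
  have E: "E \<theta> * inverse (E \<theta>) = 1" using pos(2)[of \<theta>] by simp
  have "k\<^sup>2 * (a \<theta>)\<^sup>2 + (p - 1) * (b \<theta>)\<^sup>2 = E \<theta>" by (simp add: E_def)
  then have "flux2 \<theta> = \<rho> \<theta> powr ((p - 4) / 2) *
      ((p - 2) * k * a \<theta> * b \<theta> * (\<mu> * \<phi> \<theta>) + E \<theta> * \<phi>' \<theta>)" by (simp add: flux2_def)
  also have "E \<theta> * \<phi>' \<theta> = (E \<theta> * inverse (E \<theta>)) * (- ((p - 2) * k * (k - 1) * \<nu> * a \<theta> * b \<theta>) * \<phi> \<theta>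
      - 2 * real N * (p - 1) * (k - 1) * \<rho> \<theta> * \<rho> \<theta> powr (\<nu> / 2) * sin (l * \<tau> \<theta>))"
    unfolding \<phi>'_def l_omega divide_inverse by algebra
  also have "\<rho> \<theta> powr ((p - 4) / 2) * ((p - 2) * k * a \<theta> * b \<theta> * (\<mu> * \<phi> \<theta>) + \<dots>)
     = - 2 * real N * (p - 1) * (k - 1) * (\<rho> \<theta> powr ((p - 4) / 2) * \<rho> \<theta> powr (\<nu> / 2) * \<rho> \<theta>) * sin (l * \<tau> \<theta>)"
    unfolding E \<mu>_def by algebra
  finally show ?thesis unfolding K_eq .
qed

text \<open>The cosine coefficient simplifies by the determinant of the matrix: with X = k a and Y =
  b, (Y^2 + (p-1) X^2) (X^2 + (p-1) Y^2) - (p-2)^2 X^2 Y^2 = (p-1) (X^2 + Y^2)^2.\<close>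

lemma flux1_eq: "flux1 \<theta> = K \<theta> * (p - 1) * (k - 1) *
   (\<rho> \<theta> * \<nu> * cos (l * \<tau> \<theta>) - 2 * real N * (p - 2) * k * a \<theta> * b \<theta> * sin (l * \<tau> \<theta>)) / E \<theta>"
proof -
  define X where "X = k * a \<theta>"
  define Y where "Y = b \<theta>"
  define i where "i = inverse (E \<theta>)"
  define R where "R = \<rho> \<theta>"
  define q where "q = R powr (\<nu> / 2)"
  define C where "C = cos (l * \<tau> \<theta>)"
  define S where "S = sin (l * \<tau> \<theta>)"
  have E: "E \<theta> * i = 1" using pos(2)[of \<theta>] by (simp add: i_def)
  have EX: "E \<theta> = (p - 1) * Y\<^sup>2 + X\<^sup>2" unfolding E_def X_def Y_def by algebra
  have R: "R = X\<^sup>2 + Y\<^sup>2" unfolding R_def \<rho>_def X_def Y_def by algebra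
  have f: "\<phi> \<theta> = q * C" by (simp add: \<phi>_def q_def R_def C_def)
  have f': "\<phi>' \<theta> = i * q * (- ((p - 2) * (k - 1) * \<nu> * X * Y) * C - 2 * real N * (p - 1) * (k - 1) * R * S)"
    unfolding \<phi>'_def l_omega f X_def Y_def i_def R_def[symmetric] q_def S_def[symmetric] divide_inverse
    by algebra
  have "(Y\<^sup>2 + (p - 1) * X\<^sup>2) * (\<mu> * \<phi> \<theta>) + (p - 2) * X * Y * \<phi>' \<theta>
     = (Y\<^sup>2 + (p - 1) * X\<^sup>2) * (E \<theta> * i) * (\<mu> * \<phi> \<theta>) + (p - 2) * X * Y * \<phi>' \<theta>"
    by (simp add: E)
  also have "\<dots> = q * R * (p - 1) * (k - 1) * (R * \<nu> * C - 2 * real N * (p - 2) * X * Y * S) * i"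
    unfolding f f' \<mu>_def EX R by algebra
  finally have e: "(Y\<^sup>2 + (p - 1) * X\<^sup>2) * (\<mu> * \<phi> \<theta>) + (p - 2) * X * Y * \<phi>' \<theta> = \<dots>" .
  have "flux1 \<theta> = \<rho> \<theta> powr ((p - 4) / 2) *
    ((Y\<^sup>2 + (p - 1) * X\<^sup>2) * (\<mu> * \<phi> \<theta>) + (p - 2) * X * Y * \<phi>' \<theta>)"
    by (simp add: flux1_def X_def Y_def power_mult_distrib mult_ac)
  also have "\<dots> = (\<rho> \<theta> powr ((p - 4) / 2) * q * R) * (p - 1) * (k - 1) *
      (R * \<nu> * C - 2 * real N * (p - 2) * X * Y * S) * i"
    unfolding e by algebra
  also have "\<rho> \<theta> powr ((p - 4) / 2) * q * R = K \<theta>" using K_eq by (simp add: q_def R_def)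
  finally show ?thesis by (simp add: X_def Y_def R_def C_def S_def i_def divide_inverse)
qed

text \<open>This is the linearized equation after separation of r. The cosine terms match by the
  quadratic equation for \<nu>, the sine terms by (p - 2 + \<nu>) (k - 1) = (p - 2) (k - 1) +
  \<mu>.\<close>

lemma dflux2: "(flux2 has_real_derivative - ((p - 2) * (k - 1) + \<mu>) * flux1 \<theta>) (at \<theta>)"
proof -
  have "flux2 = (\<lambda>\<theta>. - 2 * real N * (p - 1) * (k - 1) * K \<theta> * sin (l * \<tau> \<theta>))"
    by (rule ext) (rule flux2_eq)
  moreover have "((\<lambda>\<theta>. - 2 * real N * (p - 1) * (k - 1) * K \<theta> * sin (l * \<tau> \<theta>)) has_real_derivative
     - 2 * real N * (p - 1) * (k - 1) * (- ((p - 2 + \<nu>) * (p - 2) * k * (k - 1) * a \<theta> * b \<theta> / E \<theta>) * K \<theta>) * sin (l * \<tau> \<theta>)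
     + - 2 * real N * (p - 1) * (k - 1) * K \<theta> * (cos (l * \<tau> \<theta>) * (l * \<omega> \<theta>))) (at \<theta>)"
  proof -
    have "2 * ((p - 2 + \<nu>) / 2) = p - 2 + \<nu>" by simp
    then have "(K has_real_derivative - ((p - 2 + \<nu>) * (p - 2) * k * (k - 1) * a \<theta> * b \<theta> / E \<theta>) * K \<theta>) (at \<theta>)"
      using dpowr[of "(p - 2 + \<nu>) / 2" \<theta>] unfolding K_def[abs_def] by (simp only:)
    then show ?thesis by (auto intro!: derivative_eq_intros tau(1))
  qed
  moreover have "- 2 * real N * (p - 1) * (k - 1) * (- ((p - 2 + \<nu>) * (p - 2) * k * (k - 1) * a \<theta> * b \<theta> / E \<theta>) * K \<theta>) * sin (l * \<tau> \<theta>)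
     + - 2 * real N * (p - 1) * (k - 1) * K \<theta> * (cos (l * \<tau> \<theta>) * (l * \<omega> \<theta>))
     = - ((p - 2) * (k - 1) + \<mu>) * flux1 \<theta>" (is "?l = ?r")
  proof -
    have "?r = K \<theta> * (p - 1) * (k - 1) * (- (k - 1) * (\<nu> * (\<nu> + (p - 2))) * \<rho> \<theta> * cos (l * \<tau> \<theta>)
      + (p - 2 + \<nu>) * (k - 1) * 2 * real N * (p - 2) * k * a \<theta> * b \<theta> * sin (l * \<tau> \<theta>)) * inverse (E \<theta>)"
      unfolding flux1_eq \<mu>_def divide_inverse by algebra
    also have "\<dots> = ?l" unfolding nu l_omega divide_inverse by algebra
    finally show ?thesis by simp
  qed
  ultimately show ?thesis by simp
qed

section \<open>Periodicity and mean value\<close>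

lemma periodic_b: "b (\<theta> + 2 * pi / real N) = b \<theta>"
  by (rule periodic_deriv[OF periodic da])

lemma same_trig:
  assumes "a x = a y" "b x = b y"
  shows "cos (\<tau> x) = cos (\<tau> y)" "sin (\<tau> x) = sin (\<tau> y)"
proof -
  have P: "P x = P y" using assms by (simp add: P_def)
  then have q: "sqrt (P x) \<noteq> 0" using pos(3)[of x] by simp
  have "sqrt (P x) * cos (\<tau> x) = sqrt (P x) * cos (\<tau> y)"
    using tau(2)[of x, symmetric] tau(2)[of y, symmetric] assms P by (simp only:)
  then show "cos (\<tau> x) = cos (\<tau> y)" using mult_left_cancel[OF q] by blast
  have "sqrt (P x) * sin (\<tau> x) = sqrt (P x) * sin (\<tau> y)"
    using tau(3)[of x, symmetric] tau(3)[of y, symmetric] assms P by (simp only:)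
  then show "sin (\<tau> x) = sin (\<tau> y)" using mult_left_cancel[OF q] by blast
qed

lemma same_lift:
  assumes "a x = a y" "b x = b y"
  obtains n :: int where "\<tau> x = \<tau> y + 2 * pi * n"
  using same_trig[OF assms] sin_cos_eq_iff[of "\<tau> x" "\<tau> y"] by auto

text \<open>The values of \<open>a\<close> and \<open>b\<close> fix the phase only up to a multiple
  of 2 pi; as l is an integer, cos (l \<tau>) does not see the difference.\<close>

lemma same_phi:
  assumes "a x = a y" "b x = b y"
  shows "\<phi> x = \<phi> y"
proof -
  obtain n :: int where n: "\<tau> x = \<tau> y + 2 * pi * n" using same_lift[OF assms] .
  have "l * \<tau> x = l * \<tau> y + 2 * pi * real_of_int (2 * (int N - 1) * n)"
    by (simp add: n l_def algebra_simps)
  then have "cos (l * \<tau> x) = cos (l * \<tau> y)"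
    by (simp only: cos_add cos_int_2pin sin_int_2pin mult_1_right mult_zero_right diff_zero)
  then show ?thesis using assms by (simp add: \<phi>_def \<rho>_def)
qed

lemma periodic_phi: "\<phi> (\<theta> + 2 * pi / real N) = \<phi> \<theta>"
  by (rule same_phi) (rule periodic periodic_b)+

lemma full_period: "a (t + 2 * pi) = a t" "\<phi> (t + 2 * pi) = \<phi> t"
proof -
  have e: "of_int (int N) * (2 * pi / real N) = 2 * pi" using N2 by simp
  show "a (t + 2 * pi) = a t"
    using periodic_int_multiple[of a _ t "int N", OF periodic] unfolding e .
  show "\<phi> (t + 2 * pi) = \<phi> t"
    using periodic_int_multiple[of \<phi> _ t "int N", OF periodic_phi] unfolding e .
qed

text \<open>Admits c = m \<kappa> in the Fourier coefficient: (p - 1) (k - 1) m \<kappa> = (p - 1) k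
  - (p - 2) exceeds (p - 1) (k - 1) by exactly 1.\<close>

lemma m_kappa_gt_1: "m * \<kappa> > 1"
proof -
  have "(p - 1) * ((k - 1) * (m * \<kappa>)) = (p - 1) * (m * (k - 1)) * \<kappa>" by algebra
  also have "\<dots> = (p - 1) * k * \<kappa>\<^sup>2" unfolding m_kappa by algebra
  also have "\<dots> > (p - 1) * (k - 1)" unfolding kappa_sq using p2 by (simp add: algebra_simps)
  finally have "(k - 1) * 1 < (k - 1) * (m * \<kappa>)" using p2 by simp
  then show ?thesis using k1 by (simp only: mult_less_cancel_left_pos diff_gt_0_iff_gt)
qed

text \<open>Substituting \<open>\<tau>\<close> for \<open>\<theta>\<close> turns the mean of \<open>\<phi>\<close> into a Fourier coefficient of a
  power of \<open>D\<close>.\<close>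

lemma phi_integral: "integral {0..2 * pi} \<phi> \<noteq> 0"
proof -
  \<comment> \<open>The exponent of 1 / D that results when \<rho>, a multiple of D^(-(k-1)), is
    raised to the power \<nu> / 2.\<close>
  define s where "s = (k - 1) * \<nu> / 2"
  have s: "s > 0" using k1 nu(1) by (simp add: s_def)
  obtain c where c: "c > 0" "\<And>\<theta>. \<rho> \<theta> = c * D (\<tau> \<theta>) powr (- (k - 1))" using rho_powr by blast
  \<comment> \<open>The division by m compensates the right-hand side of
    \<open>dtheta_dtau\<close>.\<close>
  define C where "C = c powr (\<nu> / 2) / m"
  have C: "C \<noteq> 0" using c(1) m_pos by (simp add: C_def)
  have l: "l = 2 * real (N - 1)" using N2 by (simp add: l_def of_nat_diff)
  define H where "H t = D t powr (- s) * (m * \<kappa> / D t - 1) * cos (2 * real (N - 1) * t)" for t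
  have D_nz: "D t \<noteq> 0" for t using D_pos[of t] by simp
  have phi: "\<phi> \<theta> = C * H (\<tau> \<theta>) * \<omega> \<theta>" for \<theta>
  proof -
    have "\<rho> \<theta> powr (\<nu> / 2) = c powr (\<nu> / 2) * D (\<tau> \<theta>) powr (- s)"
    proof -
      have "- (k - 1) * (\<nu> / 2) = - s"
        unfolding s_def times_divide_eq_right mult_minus_left minus_divide_left ..
      then show ?thesis using c(1) by (simp only: c(2) powr_mult powr_powr)
    qed
    moreover have "C * H (\<tau> \<theta>) * \<omega> \<theta> = C * D (\<tau> \<theta>) powr (- s) * cos (l * \<tau> \<theta>) * (\<omega> \<theta> * (m * \<kappa> / D (\<tau> \<theta>) - 1))"
      unfolding H_def l by (simp only: mult_ac)
    moreover have "c powr (\<nu> / 2) = C * m" using m_pos by (simp add: C_def)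
    ultimately show ?thesis unfolding dtheta_dtau \<phi>_def by (simp only: mult_ac)
  qed
  have "isCont H t" for t
    unfolding H_def D_def
    using D_nz[of t] unfolding D_def by (intro continuous_intros) auto
  then obtain F where F: "\<And>t. (F has_real_derivative H t) (at t)"
    using exists_antiderivative by blast
  have "((\<lambda>\<theta>. C * F (\<tau> \<theta>)) has_real_derivative \<phi> \<theta>) (at \<theta>)" for \<theta>
    using DERIV_cmult[OF DERIV_chain2[OF F tau(1)[of \<theta>]], of C] unfolding phi by (simp only: mult.assoc)
  then have "(\<phi> has_integral C * F (\<tau> (2 * pi)) - C * F (\<tau> 0)) {0..2 * pi}"
    by (intro fundamental_theorem_of_calculus)
      (auto simp flip: has_real_derivative_iff_has_vector_derivative intro: has_field_derivative_at_within)
  then have int: "integral {0..2 * pi} \<phi> = C * (F (\<tau> (2 * pi)) - F (\<tau> 0))"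
    by (simp add: integral_unique right_diff_distrib)
  define J where "J = integral {0..2 * pi} H"
  have J: "J \<noteq> 0"
    using fourier_coefficient_pos[OF kappa(1,2) s less_imp_le[OF m_kappa_gt_1], of "N - 1"]
    unfolding J_def H_def D_def by auto
  have "(H has_integral F (2 * pi) - F 0) {0..2 * pi}"
    using F by (intro fundamental_theorem_of_calculus)
      (auto simp flip: has_real_derivative_iff_has_vector_derivative intro: has_field_derivative_at_within)
  then have FJ: "F (2 * pi) - F 0 = J" by (simp add: J_def integral_unique)
  have Hper: "H (t + 2 * pi) = H t" for t
  proof -
    have "2 * real (N - 1) * (t + 2 * pi) = 2 * real (N - 1) * t + 2 * pi * real_of_int (2 * int (N - 1))"
      by (simp add: algebra_simps)
    then show ?thesis unfolding H_def D_def
      by (simp only: cos_add cos_int_2pin sin_int_2pin sin_periodic cos_periodic) simp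
  qed
  \<comment> \<open>The antiderivative grows by the same amount J over every period, wherever the
    period starts.\<close>
  have "((\<lambda>t. F (t + 2 * pi) - F t) has_real_derivative 0) (at t)" for t
  proof -
    have "((\<lambda>t. F (t + 2 * pi)) has_real_derivative H (t + 2 * pi)) (at t)"
      using F DERIV_shift by blast
    from DERIV_diff[OF this F[of t]] show ?thesis by (simp add: Hper)
  qed
  from deriv_zero_imp_const[OF this] have step: "F (t + 2 * pi) = F t + J" for t
    using FJ by (metis add_0 diff_add_cancel add.commute)
  have steps: "F (t + real i * (2 * pi)) = F t + real i * J" for t i
  proof (induction i)
    case (Suc i)
    have "F (t + real (Suc i) * (2 * pi)) = F ((t + real i * (2 * pi)) + 2 * pi)"
      by (simp add: algebra_simps)
    then show ?case unfolding step Suc by (simp add: algebra_simps)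
  qed simp
  have "b (2 * pi) = b 0"
    using periodic_deriv[of a "2 * pi" b 0, OF full_period(1) da] by simp
  moreover have "a (2 * pi) = a 0" using full_period(1)[of 0] by simp
  ultimately obtain n :: int where n: "\<tau> (2 * pi) = \<tau> 0 + 2 * pi * n" using same_lift by blast
  \<comment> \<open>The phase makes n full turns while \<theta> runs from 0 to 2 pi. Monotonicity
    makes n positive, so the integral is C n J with all three factors nonzero.\<close>
  have "\<tau> 0 < \<tau> (2 * pi)"
    by (rule DERIV_pos_imp_increasing) (use tau(1) omega_pos in auto)
  then have "n > 0" using n by (simp add: zero_less_mult_iff)
  then have "\<tau> (2 * pi) = \<tau> 0 + real (nat n) * (2 * pi)" unfolding n by simp
  then have "F (\<tau> (2 * pi)) - F (\<tau> 0) = real (nat n) * J" using steps by simp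
  then show ?thesis unfolding int using C J \<open>n > 0\<close> by simp
qed

section \<open>The solution on the punctured disc\<close>

definition v where "v = homogeneous \<mu> \<phi>"

lemma v_polar: "r > 0 \<Longrightarrow> v (polar r t) = r powr \<mu> * \<phi> t"
  unfolding v_def by (rule homogeneous_polar[of \<phi>, OF full_period(2)])

lemma mu_pos: "\<mu> > 0" using k1 nu(1) by (simp add: \<mu>_def)

lemma dv_radial: "r > 0 \<Longrightarrow> ((\<lambda>s. v (polar s t)) has_real_derivative \<mu> * r powr (\<mu> - 1) * \<phi> t) (at r)"
  using DERIV_cmult_right[OF has_real_derivative_powr[of r \<mu>], of "\<phi> t"]
  by (rule has_field_derivative_transform_within_open[of _ _ _ "{0<..}"]) (auto simp: v_polar)

lemma frame_grad_v:
  assumes "r > 0"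
  shows "frame_grad (\<lambda>s t. v (polar s t)) r t = vector [r powr (\<mu> - 1) * (\<mu> * \<phi> t), r powr (\<mu> - 1) * \<phi>' t]"
proof -
  have 1: "deriv (\<lambda>s. v (polar s t)) r = r powr (\<mu> - 1) * (\<mu> * \<phi> t)"
    using DERIV_imp_deriv[OF dv_radial[OF assms]] by simp
  have "(\<lambda>t. v (polar r t)) = (\<lambda>t. r powr \<mu> * \<phi> t)" using v_polar[OF assms] by auto
  then have "deriv (\<lambda>t. v (polar r t)) t = r powr \<mu> * \<phi>' t"
    using DERIV_imp_deriv[OF DERIV_cmult[OF dphi]] by simp
  moreover have "r powr \<mu> = r * r powr (\<mu> - 1)"
    using powr_mult_base[of r "\<mu> - 1"] assms by simp
  ultimately have "deriv (\<lambda>t. v (polar r t)) t = r * (r powr (\<mu> - 1) * \<phi>' t)"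
    by (simp only: mult.assoc)
  then show ?thesis using assms unfolding frame_grad_def 1 by simp
qed

lemma flux_v:
  assumes "r > 0"
  defines "e \<equiv> (p - 2) * (k - 1)"
  shows "(A_matrix p k a r t *v frame_grad (\<lambda>s t. v (polar s t)) r t) $ 1 = r powr (e + \<mu> - 1) * flux1 t"
    and "(A_matrix p k a r t *v frame_grad (\<lambda>s t. v (polar s t)) r t) $ 2 = r powr (e + \<mu> - 1) * flux2 t"
proof -
  have b: "deriv a = b" using DERIV_imp_deriv[OF da] by auto
  have rho: "(b t)\<^sup>2 + k\<^sup>2 * (a t)\<^sup>2 = \<rho> t" by (simp add: \<rho>_def)
  have e: "r powr e * r powr (\<mu> - 1) = r powr (e + \<mu> - 1)"
    by (simp add: add_diff_eq flip: powr_add)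
  show "(A_matrix p k a r t *v frame_grad (\<lambda>s t. v (polar s t)) r t) $ 1 = r powr (e + \<mu> - 1) * flux1 t"
    "(A_matrix p k a r t *v frame_grad (\<lambda>s t. v (polar s t)) r t) $ 2 = r powr (e + \<mu> - 1) * flux2 t"
    unfolding frame_grad_v[OF assms(1)] A_matrix_def b rho e_def[symmetric] e[symmetric] flux1_def flux2_def
    by (simp_all add: matrix_vector_mult_def sum_2 algebra_simps)
qed

text \<open>The factor s in \<open>frame_div\<close> raises the power in the radial term to e +
  \<mu>, so differentiation in r brings down this factor in front of \<open>flux1\<close>; by
  \<open>dflux2\<close> the angular term is the negative of the result.\<close>

lemma v_solves: "solves_linearized p k a v"
  unfolding solves_linearized_def
proof (intro allI impI)
  fix r t :: real assume "0 < r \<and> r < 1"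
  then have r: "r > 0" by simp
  define e where "e = (p - 2) * (k - 1)"
  define F where "F s t = A_matrix p k a s t *v frame_grad (\<lambda>s t. v (polar s t)) s t" for s t
  have F: "F s t $ 1 = s powr (e + \<mu> - 1) * flux1 t" "F s t $ 2 = s powr (e + \<mu> - 1) * flux2 t"
    if "s > 0" for s t
    unfolding F_def e_def by (rule flux_v[OF that])+
  have "((\<lambda>s. s * (F s t $ 1)) has_real_derivative (e + \<mu>) * r powr (e + \<mu> - 1) * flux1 t) (at r)"
  proof (rule has_field_derivative_transform_within_open)
    show "((\<lambda>s. s powr (e + \<mu>) * flux1 t) has_real_derivative (e + \<mu>) * r powr (e + \<mu> - 1) * flux1 t) (at r)"
      using DERIV_cmult_right[OF has_real_derivative_powr[OF r, of "e + \<mu>"], of "flux1 t"] .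
    show "s powr (e + \<mu>) * flux1 t = s * (F s t $ 1)" if "s \<in> {0<..}" for s
    proof -
      have "s powr (e + \<mu>) = s * s powr (e + \<mu> - 1)" using that powr_add[of s 1 "e + \<mu> - 1"] by simp
      then show ?thesis using that by (simp add: F)
    qed
  qed (use r in auto)
  then have 1: "deriv (\<lambda>s. s * (F s t $ 1)) r = (e + \<mu>) * r powr (e + \<mu> - 1) * flux1 t"
    by (rule DERIV_imp_deriv)
  have "(\<lambda>t. F r t $ 2) = (\<lambda>t. r powr (e + \<mu> - 1) * flux2 t)" using F(2)[OF r] by auto
  then have 2: "deriv (\<lambda>t. F r t $ 2) t = r powr (e + \<mu> - 1) * (- (e + \<mu>) * flux1 t)"
    using DERIV_imp_deriv[OF DERIV_cmult[OF dflux2]] by (simp add: e_def)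
  have "frame_div F r t = 0" unfolding frame_div_def 1 2 by (simp add: algebra_simps)
  then show "frame_div (\<lambda>s t. A_matrix p k a s t *v frame_grad (\<lambda>s t. v (polar s t)) s t) r t = 0"
    unfolding F_def[abs_def] .
qed

text \<open>\<open>v\<close> is given beyond the unit circle, so the one-sided derivative at radius
  1 is read off from the two-sided one.\<close>

lemma normal_deriv_v: "normal_deriv v t = \<mu> * \<phi> t"
proof -
  have "((\<lambda>s. v (polar s t)) has_vector_derivative \<mu> * \<phi> t) (at_left 1)"
    using dv_radial[of 1 t] by (simp add: has_real_derivative_iff_has_vector_derivative has_vector_derivative_at_within)
  then show ?thesis unfolding normal_deriv_def
    by (rule vector_derivative_within[rotated]) (rule trivial_limit_at_left_real)
qed

lemma v_smooth: "smooth_on (cball 0 1 - {0}) v"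
  unfolding smooth_on_def v_def
  using Cn_on_homogeneous[OF full_period(2) smooth_phi]
  by (intro exI[of _ "- {0}"] exI[of _ "homogeneous \<mu> \<phi>"]) auto

end

section \<open>Existence of a solution with nonzero mean normal derivative\<close>

theorem theorem1p1:
  fixes p k \<beta> :: real and N :: nat and a :: "real \<Rightarrow> real"
  assumes "p > 2" and "N \<ge> 1"
    and "is_exponent p N k"
    and "is_angular_profile p N k a"
    and "alpha p k - 1 < \<beta>" and "\<beta> < 2 * alpha p k - 1"
  shows "\<exists>v. v \<in> Y1 N (alpha p k) \<beta> \<and>
           smooth_on (cball 0 1 - {0}) v \<and>
           solves_linearized p k a v \<and>
           integral {0..2 * pi} (normal_deriv v) \<noteq> 0"
proof -
  \<comment> \<open>That the interval for \<beta> is nonempty forces \<alpha> > 0, and hence k >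
    1.\<close>
  have alpha_pos: "alpha p k > 0" using assms(5,6) by linarith
  have k1: "k > 1"
    using alpha_pos \<open>p > 2\<close> by (simp add: alpha_def zero_less_mult_iff)
  have ep: "exponent_poly p N k = 0" using assms(3) by (simp add: is_exponent_def)
  have "smooth_on UNIV a" using assms(4) by (simp add: is_angular_profile_def)
  then obtain U g where "UNIV \<subseteq> U" "\<And>x. g x = a x" "\<And>n. Cn_on n U g"
    by (auto simp: smooth_on_def)
  then have "U = UNIV" "g = a" by auto
  then have sm: "Cn_on n UNIV a" for n using \<open>\<And>n. Cn_on n U g\<close> by simp
  obtain b where da: "\<And>t. (a has_real_derivative b t) (at t)"
    using Cn_on_Suc_realE[OF sm[of "Suc 0"]] by blast
  obtain c where db: "\<And>t. (b has_real_derivative c t) (at t)"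
    using Cn_on_Suc_realE[OF Cn_on_real_deriv[OF sm[of "Suc (Suc 0)"] da]] by blast
  have "deriv a = b" using DERIV_imp_deriv[OF da] by auto
  moreover have "deriv b = c" using DERIV_imp_deriv[OF db] by auto
  ultimately have "c t + potential p k (a t) (b t) * a t = 0" for t
    using assms(4) by (auto simp: is_angular_profile_def)
  then have "c t = - potential p k (a t) (b t) * a t" for t
    by (simp add: eq_neg_iff_add_eq_0)
  then have ode: "(b has_real_derivative - potential p k (a t) (b t) * a t) (at t)" for t
    using db[of t] by simp
  obtain t0 where "a t0 \<noteq> 0" using assms(4) by (auto simp: is_angular_profile_def)
  then have nv: "a t \<noteq> 0 \<or> b t \<noteq> 0" for t
    by (rule profile_nonvanishing[OF \<open>p > 2\<close> less_imp_le[OF k1] da ode])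
  interpret angular_profile p k N a b
  proof
    show "p > 2" "k > 1" by fact+
    show "N \<ge> 2" "(real N - 1)\<^sup>2 * ((p - 1) * k\<^sup>2 - (p - 2) * k) = (p - 1) * (real N)\<^sup>2 * (k - 1)\<^sup>2"
      by (rule exponent_relation[OF assms(1,2) k1 ep])+
    show "a (t + 2 * pi / real N) = a t" for t using assms(4) by (simp add: is_angular_profile_def)
  qed (rule da ode nv sm)+
  \<comment> \<open>Both weight conditions follow from \<mu> > 0 and \<beta> > \<alpha> - 1 >
    -1.\<close>
  have "v \<in> Y1 N (alpha p k) \<beta>"
    unfolding v_def using mu_pos assms(5) alpha_pos
    by (intro homogeneous_in_Y1 full_period periodic_phi smooth_phi) auto
  moreover have "integral {0..2 * pi} (normal_deriv v) \<noteq> 0"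
  proof -
    have "normal_deriv v = (\<lambda>t. \<mu> * \<phi> t)" by (rule ext) (rule normal_deriv_v)
    then show ?thesis using phi_integral mu_pos by simp
  qed
  ultimately show ?thesis using v_smooth v_solves by blast
qed

end
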